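(* Let $y_0$ and $\mathbf v_0$ be $\mathbb R^2$-valued functions and let $\eta_0$ be a real-valued function, all defined and real analytic in a neighborhood of $\xi=0$ in $\mathbb R$, with $y_0(0)=0$ and $\eta_0(0)>0$. Let $\rho^{\pm}:\mathbb R\times\mathbb R^2\to\mathbb R_+$ and $\mathbf v^{\pm}:\mathbb R\times\mathbb R^2\to\mathbb R^2$ be functions $(t,x)\mapsto\rho^\pm(t,x)$, $(t,x)\mapsto\mathbf v^\pm(t,x)$ that are real analytic in a neighborhood of the point $(t,x)=(0,0)$. Then there exist a neighborhood of the origin $(t,\xi)=(0,0)$ in $\mathbb R^2$ and real analytic functions $y$, $\mathbf v$, $\mathbf p$ (with values in $\mathbb R^2$) and $\eta$ (with nonvanishing real values) of $(t,\xi)$ on this neighborhood, with $\mathbf p=y_\xi$, that satisfy there the system $$ \left\{\begin{array}{rl} y_t&=\ \mathbf v,\\[2mm] \eta_t&=\ \mathbf p\times(\mathbf v-\mathbf v^+)\,\rho^+-\mathbf p\times(\mathbf v-\mathbf v^-)\,\rho^-,\\[2mm] \mathbf v_t&=\ \displaystyle\big(\mathbf p\times(\mathbf v-\mathbf v^+)\big)\rho^+\,\frac{\mathbf v^+-\mathbf v}{\eta}-\big(\mathbf p\times(\mathbf v-\mathbf v^-)\big)\rho^-\,\frac{\mathbf v^--\mathbf v}{\eta},\\[2mm] \mathbf p_t-\mathbf v_\xi&=\ 0, \end{array}\right. $$ where $\rho^\pm$ and $\mathbf v^\pm$ are evaluated at $(t,y(t,\xi))$, together with the initial conditions $$y(0,\xi)=y_0(\xi),\qquad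 \eta(0,\xi)=\eta_0(\xi),\qquad \mathbf v(0,\xi)=\mathbf v_0(\xi)$$ for all $\xi$ near $0$.
   Context: For vectors $\mathbf u=(u_1,u_2)$ and $\mathbf v=(v_1,v_2)$ in $\mathbb R^2$, the cross product is the scalar $\mathbf u\times\mathbf v=u_1v_2-u_2v_1$. Subscripts $t$ and $\xi$ denote partial derivatives. $\mathbb R_+$ denotes the nonnegative reals. The system describes a singular curve $\xi\mapsto y(t,\xi)$ in the plane carrying mass, for the two-dimensional pressureless gas equations: $\eta(t,\xi)$ is the linear mass density (with respect to $d\xi$) and $\mathbf v(t,\xi)$ the velocity of particles on the curve, $\mathbf p=y_\xi$, while $\rho^\pm,\mathbf v^\pm$ are the given density and velocity of the gas in front of ($+$) and behind ($-$) the curve. The initial value of $\mathbf p$ is thus $\mathbf p(0,\xi)=y_0'(\xi)$. *)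

theory Defs
  imports "HOL-Analysis.Analysis"
begin

text \<open>
  Multi-indices are the maps from the standard basis to the naturals.  The power series is
  required to converge unconditionally, which for finite-dimensional targets is the same as
  absolute convergence.
\<close>

definition real_analytic_at :: "('a::euclidean_space \<Rightarrow> 'b::real_normed_vector) \<Rightarrow> 'a \<Rightarrow> bool"
  where "real_analytic_at f a \<longleftrightarrow>
    (\<exists>r>0. \<exists>c :: ('a \<Rightarrow> nat) \<Rightarrow> 'b. \<forall>x\<in>ball a r.
      ((\<lambda>\<alpha>. (\<Prod>b\<in>Basis. ((x - a) \<bullet> b) ^ \<alpha> b) *\<^sub>R c \<alpha>) has_sum f x) (Basis \<rightarrow>\<^sub>E UNIV))"

definition real_analytic_on :: "('a::euclidean_space \<Rightarrow> 'b::real_normed_vector) \<Rightarrow> 'a set \<Rightarrow> bool"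
    (infixl "real'_analytic'_on" 50)
  where "f real_analytic_on S \<longleftrightarrow> (\<forall>a\<in>S. real_analytic_at f a)"

definition cross2 :: "real^2 \<Rightarrow> real^2 \<Rightarrow> real"
  where "cross2 u v = u$1 * v$2 - u$2 * v$1"

text \<open>
  The two partial derivatives are total functions with arbitrary values where the derivative
  does not exist; they are meaningful for real analytic \<open>f\<close>.
\<close>

definition partial_t :: "(real \<times> real \<Rightarrow> 'b::real_normed_vector) \<Rightarrow> real \<Rightarrow> real \<Rightarrow> 'b"
  where "partial_t f t \<xi> = vector_derivative (\<lambda>s. f (s, \<xi>)) (at t)"

definition partial_xi :: "(real \<times> real \<Rightarrow> 'b::real_normed_vector) \<Rightarrow> real \<Rightarrow> real \<Rightarrow> 'b"
  where "partial_xi f t \<xi> = vector_derivative (\<lambda>s. f (t, s)) (at \<xi>)"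

end

theory Submission
  imports Defs
begin

text \<open>
  The system is solved by a contraction in one Banach algebra, which replaces the usual majorant or
  scale-of-spaces argument for the Cauchy-Kovalevskaya theorem.  After rescaling time by \<open>\<tau>\<close> and
  \<open>\<xi>\<close> by \<open>r\<close>, all unknowns are double series \<open>\<Sum> c\<^sub>i\<^sub>j t\<^sup>i x\<^sup>j\<close> with finite norm
  \<open>\<Sum> \<bar>c\<^sub>i\<^sub>j\<bar> / (i + j choose i)\<close>.  Vandermonde's identity makes this norm submultiplicative, and
  such series converge absolutely for \<open>\<bar>t\<bar> + \<bar>x\<bar> < 1\<close>.  The point of the binomial weights is that
  not only integration in \<open>t\<close> but also integration in \<open>t\<close> followed by differentiation in \<open>x\<close> has
  norm at most one.  Writing \<open>y = y\<^sub>0 + \<tau> \<integral> v\<close> and \<open>p = (y\<^sub>0' + \<tau> \<partial>\<^sub>x \<integral> v) / r\<close>, the system becomes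
  a fixed point equation for \<open>(v, \<eta>)\<close> of the form \<open>z = z\<^sub>0 + \<tau> H(z)\<close> with \<open>H\<close> bounded and Lipschitz
  near \<open>z\<^sub>0\<close> uniformly in \<open>\<tau>\<close>, hence a contraction for small \<open>\<tau>\<close>.
\<close>

section \<open>A Banach algebra of double power series\<close>

text \<open>The obstacle is that \<open>p\<close> contains an x-derivative of the unknown; with
  unweighted coefficient sums even its time integral is unbounded. In terms of derivatives, the
  weighted coefficient is the (i, j)-th partial derivative at 0 divided by (i + j)!, so the norm
  sees derivatives only through their total order. Integrating in t and differentiating in x trades
  one t for one x and keeps that order, so forming \<open>p\<close> costs nothing, and the factor
  \<tau> gained from rescaling time is fully available for the contraction. The two scales have
  different roles. The scale r is fixed first, to bring the data close to constants, so that the gas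
  fields and 1 / \<eta> can be expanded inside the algebra. The factor 1 / r in \<open>p\<close> is
  then a mere constant when \<tau> is chosen. Evaluation at a point of the diamond is a continuous
  algebra homomorphism, which turns the fixed point equation into the differential system. As
  \<open>p\<close> is computed from the velocity and is not an independent unknown, both
  \<open>p\<close> = y_\<xi> and p_t = v_\<xi> become identities between coefficients.\<close>

definition diamond_weight :: "nat \<times> nat \<Rightarrow> real"
  where "diamond_weight = (\<lambda>(i, j). 1 / real ((i + j) choose i))"

lemma diamond_weight_pos: "diamond_weight ij > 0"
  by (auto simp: diamond_weight_def split: prod.splits)

lemma diamond_weight_nonneg [simp]: "diamond_weight ij \<ge> 0"
  using diamond_weight_pos[of ij] by simp

lemma diamond_weight_zero [simp]: "diamond_weight (0, j) = 1" "diamond_weight (i, 0) = 1"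
  by (auto simp: diamond_weight_def)

lemma binomial_mult_le: "(m choose i) * (n choose k) \<le> (m + n) choose (i + k)"
proof -
  have "(m choose i) * (n choose k) = (m choose i) * (n choose ((i + k) - i))" by simp
  also have "\<dots> \<le> (\<Sum>a\<le>i + k. (m choose a) * (n choose (i + k - a)))"
    by (rule member_le_sum) auto
  also have "\<dots> = (m + n) choose (i + k)"
    by (simp add: vandermonde)
  finally show ?thesis .
qed

lemma diamond_weight_mult_le:
  "diamond_weight (i + k, j + l) \<le> diamond_weight (i, j) * diamond_weight (k, l)"
proof -
  have eq: "i + k + (j + l) = (i + j) + (k + l)" by simp
  have "real ((i + j) choose i) * real ((k + l) choose k) \<le> real (((i + j) + (k + l)) choose (i + k))"
    using binomial_mult_le[of "i + j" i "k + l" k] by (metis of_nat_le_iff of_nat_mult)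
  then have "1 / real ((i + k + (j + l)) choose (i + k)) \<le>
      1 / (real ((i + j) choose i) * real ((k + l) choose k))"
    unfolding eq by (intro divide_left_mono) auto
  then show ?thesis
    by (simp add: diamond_weight_def)
qed

text \<open>The outer index is the power of t and the inner one the power of x. Iterated formal
  power series are used so that all ring laws of the algebra come from the ring structure of
  \<open>fps\<close>.\<close>

definition fps2_nth :: "real fps fps \<Rightarrow> nat \<times> nat \<Rightarrow> real"
  where "fps2_nth f = (\<lambda>(i, j). fps_nth (fps_nth f i) j)"

lemma fps2_nth_mult:
  "fps2_nth (f * g) (m, n) = (\<Sum>(i, j)\<in>{..m} \<times> {..n}. fps2_nth f (i, j) * fps2_nth g (m - i, n - j))"
  by (simp add: fps2_nth_def fps_mult_nth fps_sum_nth atLeast0AtMost sum.cartesian_product)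

lemma fps2_eqI: "(\<And>i j. fps2_nth f (i, j) = fps2_nth g (i, j)) \<Longrightarrow> f = g"
  by (simp add: fps2_nth_def fps_eq_iff)

lemma summable_on_Times_mult:
  fixes f :: "'a \<Rightarrow> real" and g :: "'b \<Rightarrow> real"
  assumes "f summable_on A" "g summable_on B" "\<And>x. f x \<ge> 0" "\<And>y. g y \<ge> 0"
  shows "(\<lambda>(x, y). f x * g y) summable_on A \<times> B"
  by (rule summable_on_SigmaI[where g="\<lambda>x. f x * infsum g B"])
    (use assms in \<open>auto intro: has_sum_cmult_right has_sum_infsum summable_on_cmult_left\<close>)

text \<open>A quadruple of exponents is regrouped as the pair of total exponents together with the
  pair of the first factor. \<open>H\<close> is an arbitrary function of two pairs, so one
  regrouping serves both the norm estimate and the evaluation at a point.\<close>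

lemma has_sum_cauchy_product2:
  fixes H :: "nat \<times> nat \<Rightarrow> nat \<times> nat \<Rightarrow> real"
  assumes "((\<lambda>((i, j), (k, l)). H (i, j) (k, l)) has_sum s) (UNIV \<times> UNIV)"
  shows "((\<lambda>(m, n). \<Sum>(i, j)\<in>{..m} \<times> {..n}. H (i, j) (m - i, n - j)) has_sum (s :: real)) UNIV"
proof -
  let ?S = "SIGMA mn:(UNIV :: (nat \<times> nat) set). {..fst mn} \<times> {..snd mn}"
  have "((\<lambda>(mn, ij). H ij (fst mn - fst ij, snd mn - snd ij)) has_sum s) ?S \<longleftrightarrow>
     ((\<lambda>((i, j), (k, l)). H (i, j) (k, l)) has_sum s) (UNIV \<times> UNIV)"
    by (rule has_sum_reindex_bij_witness
        [where i = "\<lambda>((i, j), (k, l)). ((i + k, j + l), (i, j))" and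
          j = "\<lambda>(mn, ij). (ij, (fst mn - fst ij, snd mn - snd ij))"]) auto
  then have "((\<lambda>(mn, ij). H ij (fst mn - fst ij, snd mn - snd ij)) has_sum s) ?S"
    using assms by simp
  then have "((\<lambda>mn. \<Sum>ij\<in>{..fst mn} \<times> {..snd mn}. H ij (fst mn - fst ij, snd mn - snd ij)) has_sum s) UNIV"
    by (rule has_sum_SigmaD) (auto intro!: has_sum_finite)
  then show ?thesis
    by (simp add: case_prod_unfold)
qed

text \<open>By the triangle inequality and the submultiplicativity of \<open>w\<close>, each
  weighted coefficient of the product is at most the corresponding coefficient of the Cauchy product
  of the two weighted absolute families, and those coefficients sum to the product of the two
  sums.\<close>

lemma abs_summable_cauchy_product2:
  fixes f g w :: "nat \<times> nat \<Rightarrow> real"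
  assumes f: "(\<lambda>x. \<bar>f x\<bar> * w x) summable_on UNIV" and g: "(\<lambda>x. \<bar>g x\<bar> * w x) summable_on UNIV"
    and w: "\<And>x. w x \<ge> 0" "\<And>i j k l. w (i + k, j + l) \<le> w (i, j) * w (k, l)"
  defines "h \<equiv> \<lambda>(m, n). \<Sum>(i, j)\<in>{..m} \<times> {..n}. f (i, j) * g (m - i, n - j)"
  shows "(\<lambda>x. \<bar>h x\<bar> * w x) summable_on UNIV"
    and "(\<Sum>\<^sub>\<infinity>x. \<bar>h x\<bar> * w x) \<le> (\<Sum>\<^sub>\<infinity>x. \<bar>f x\<bar> * w x) * (\<Sum>\<^sub>\<infinity>x. \<bar>g x\<bar> * w x)"
proof -
  let ?F = "\<lambda>x. \<bar>f x\<bar> * w x" and ?G = "\<lambda>x. \<bar>g x\<bar> * w x"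
  have sm: "(\<lambda>(x, y). ?F x * ?G y) summable_on UNIV \<times> UNIV"
    by (rule summable_on_Times_mult) (use f g w in auto)
  have "infsum (\<lambda>(x, y). ?F x * ?G y) (UNIV \<times> UNIV) = infsum ?F UNIV * infsum ?G UNIV"
    using infsum_Sigma'_banach[OF sm] by (simp add: infsum_cmult_right' infsum_cmult_left')
  then have hs: "((\<lambda>(x, y). ?F x * ?G y) has_sum infsum ?F UNIV * infsum ?G UNIV) (UNIV \<times> UNIV)"
    using has_sum_infsum[OF sm] by simp
  let ?K = "\<lambda>(m, n). \<Sum>(i, j)\<in>{..m} \<times> {..n}. ?F (i, j) * ?G (m - i, n - j)"
  have K: "(?K has_sum infsum ?F UNIV * infsum ?G UNIV) UNIV"
    using has_sum_cauchy_product2[of "\<lambda>x y. ?F x * ?G y"] hs by (simp only: case_prod_unfold prod.collapse)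
  have le: "\<bar>h x\<bar> * w x \<le> ?K x" for x
  proof -
    obtain m n where x: "x = (m, n)" by force
    have "\<bar>h x\<bar> \<le> (\<Sum>(i, j)\<in>{..m} \<times> {..n}. \<bar>f (i, j)\<bar> * \<bar>g (m - i, n - j)\<bar>)"
      unfolding h_def x prod.case
      by (rule order_trans[OF sum_abs]) (auto simp: abs_mult intro!: sum_mono)
    then have "\<bar>h x\<bar> * w x \<le> (\<Sum>(i, j)\<in>{..m} \<times> {..n}. \<bar>f (i, j)\<bar> * \<bar>g (m - i, n - j)\<bar>) * w x"
      by (rule mult_right_mono) (rule w)
    also have "\<dots> = (\<Sum>(i, j)\<in>{..m} \<times> {..n}. \<bar>f (i, j)\<bar> * \<bar>g (m - i, n - j)\<bar> * w x)"
      by (simp add: sum_distrib_right case_prod_unfold)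
    also have "\<dots> \<le> ?K x"
      unfolding x prod.case
    proof (rule sum_mono, clarsimp)
      fix i j assume "i \<le> m" "j \<le> n"
      then have "w (m, n) \<le> w (i, j) * w (m - i, n - j)" using w(2)[of i "m - i" j "n - j"] by simp
      then have "\<bar>f (i, j)\<bar> * \<bar>g (m - i, n - j)\<bar> * w (m, n) \<le>
          \<bar>f (i, j)\<bar> * \<bar>g (m - i, n - j)\<bar> * (w (i, j) * w (m - i, n - j))"
        by (rule mult_left_mono) auto
      then show "\<bar>f (i, j)\<bar> * \<bar>g (m - i, n - j)\<bar> * w (m, n) \<le>
          \<bar>f (i, j)\<bar> * w (i, j) * (\<bar>g (m - i, n - j)\<bar> * w (m - i, n - j))"
        by (simp add: mult_ac)
    qed
    finally show ?thesis .
  qed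
  have nn: "0 \<le> \<bar>h x\<bar> * w x" for x using w by simp
  show s: "(\<lambda>x. \<bar>h x\<bar> * w x) summable_on UNIV"
    by (rule summable_on_comparison_test[where f="?K"]) (use has_sum_imp_summable[OF K] le nn in blast)+
  show "(\<Sum>\<^sub>\<infinity>x. \<bar>h x\<bar> * w x) \<le> infsum ?F UNIV * infsum ?G UNIV"
    using has_sum_mono[OF has_sum_infsum[OF s] K] le by simp
qed

definition fps2_norm :: "real fps fps \<Rightarrow> real"
  where "fps2_norm f = (\<Sum>\<^sub>\<infinity>x. \<bar>fps2_nth f x\<bar> * diamond_weight x)"

definition fps2_summable :: "real fps fps \<Rightarrow> bool"
  where "fps2_summable f \<longleftrightarrow> (\<lambda>x. \<bar>fps2_nth f x\<bar> * diamond_weight x) summable_on UNIV"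

lemma fps2_nth_simps [simp]:
  "fps2_nth 0 x = 0" "fps2_nth 1 x = (if x = (0, 0) then 1 else 0)"
  "fps2_nth (f + g) x = fps2_nth f x + fps2_nth g x"
  "fps2_nth (f - g) x = fps2_nth f x - fps2_nth g x"
  "fps2_nth (- f) x = - fps2_nth f x"
  "fps2_nth (fps_const (fps_const r) * f) x = r * fps2_nth f x"
  by (auto simp: fps2_nth_def split: prod.splits)

lemma fps2_summable_finite: "finite {x. fps2_nth f x \<noteq> 0} \<Longrightarrow> fps2_summable f"
  unfolding fps2_summable_def by (rule finite_nonzero_values_imp_summable_on) (auto elim: rev_finite_subset)

lemma fps2_summable_add:
  assumes "fps2_summable f" "fps2_summable g"
  shows "fps2_summable (f + g)" "fps2_norm (f + g) \<le> fps2_norm f + fps2_norm g"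
proof -
  let ?w = diamond_weight
  have s: "(\<lambda>x. \<bar>fps2_nth f x\<bar> * ?w x + \<bar>fps2_nth g x\<bar> * ?w x) summable_on UNIV"
    using assms unfolding fps2_summable_def by (rule summable_on_add)
  have le: "\<bar>fps2_nth (f + g) x\<bar> * ?w x \<le> \<bar>fps2_nth f x\<bar> * ?w x + \<bar>fps2_nth g x\<bar> * ?w x" for x
    using mult_right_mono[OF abs_triangle_ineq, of "?w x" "fps2_nth f x" "fps2_nth g x"]
    by (simp add: distrib_right)
  show "fps2_summable (f + g)"
    unfolding fps2_summable_def by (rule summable_on_comparison_test[OF s]) (use le in auto)
  then show "fps2_norm (f + g) \<le> fps2_norm f + fps2_norm g"
    using s le assms unfolding fps2_norm_def fps2_summable_def
    by (subst infsum_add[symmetric]) (auto intro!: infsum_mono)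
qed

lemma fps2_summable_scale:
  assumes "fps2_summable f"
  shows "fps2_summable (fps_const (fps_const r) * f)"
    "fps2_norm (fps_const (fps_const r) * f) = \<bar>r\<bar> * fps2_norm f"
  using assms unfolding fps2_summable_def fps2_norm_def fps2_nth_simps abs_mult mult.assoc
  by (auto intro: summable_on_cmult_right simp: infsum_cmult_right')

lemma fps2_summable_mult:
  assumes "fps2_summable f" "fps2_summable g"
  shows "fps2_summable (f * g)" "fps2_norm (f * g) \<le> fps2_norm f * fps2_norm g"
proof -
  have *: "fps2_nth (f * g) = (\<lambda>(m, n). \<Sum>(i, j)\<in>{..m} \<times> {..n}. fps2_nth f (i, j) * fps2_nth g (m - i, n - j))"
    by (auto simp: fps2_nth_mult)
  note A = abs_summable_cauchy_product2[of "fps2_nth f" diamond_weight "fps2_nth g",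
      folded *, OF _ _ diamond_weight_nonneg diamond_weight_mult_le]
  show "fps2_summable (f * g)" "fps2_norm (f * g) \<le> fps2_norm f * fps2_norm g"
    using A assms unfolding fps2_summable_def fps2_norm_def by blast+
qed

text \<open>The summable series become a type of their own, so that results stated for the type
  classes of Banach spaces and normed algebras apply to them.\<close>

typedef diamond_series = "{f. fps2_summable f}"
  morphisms series_of Abs_diamond_series
  by (rule exI[of _ 0]) (simp add: fps2_summable_finite)

setup_lifting type_definition_diamond_series

instantiation diamond_series :: real_normed_algebra_1
begin

lift_definition zero_diamond_series :: diamond_series is 0
  by (simp add: fps2_summable_finite)
lift_definition one_diamond_series :: diamond_series is 1
  by (simp add: fps2_summable_finite)
lift_definition plus_diamond_series :: "diamond_series \<Rightarrow> diamond_series \<Rightarrow> diamond_series" is "(+)"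
  by (rule fps2_summable_add)
lift_definition uminus_diamond_series :: "diamond_series \<Rightarrow> diamond_series" is "uminus"
  by (simp add: fps2_summable_def)
lift_definition minus_diamond_series :: "diamond_series \<Rightarrow> diamond_series \<Rightarrow> diamond_series" is "(-)"
  using fps2_summable_add(1)[of f "- g" for f g] by (simp add: fps2_summable_def)
lift_definition times_diamond_series :: "diamond_series \<Rightarrow> diamond_series \<Rightarrow> diamond_series" is "(*)"
  by (rule fps2_summable_mult)
lift_definition scaleR_diamond_series :: "real \<Rightarrow> diamond_series \<Rightarrow> diamond_series"
  is "\<lambda>r f. fps_const (fps_const r) * f"
  by (rule fps2_summable_scale)
lift_definition norm_diamond_series :: "diamond_series \<Rightarrow> real" is fps2_norm .

definition dist_diamond_series :: "diamond_series \<Rightarrow> diamond_series \<Rightarrow> real"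
  where "dist_diamond_series x y = norm (x - y)"
definition sgn_diamond_series :: "diamond_series \<Rightarrow> diamond_series"
  where "sgn_diamond_series x = scaleR (inverse (norm x)) x"
definition uniformity_diamond_series :: "(diamond_series \<times> diamond_series) filter"
  where "uniformity_diamond_series = (INF e\<in>{0<..}. principal {(x, y). dist x y < e})"
definition open_diamond_series :: "diamond_series set \<Rightarrow> bool"
  where "open_diamond_series U \<longleftrightarrow> (\<forall>x\<in>U. \<forall>\<^sub>F (x', y) in uniformity. x' = x \<longrightarrow> y \<in> U)"

instance
proof
  fix x y z :: diamond_series and a b :: real and U :: "diamond_series set"
  show "x + y + z = x + (y + z)" by transfer (simp add: add.assoc)
  show "x + y = y + x" by transfer (simp add: add.commute)
  show "0 + x = x" by transfer simp
  show "- x + x = 0" by transfer simp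
  show "x - y = x + - y" by transfer simp
  show "a *\<^sub>R (x + y) = a *\<^sub>R x + a *\<^sub>R y" by transfer (simp add: distrib_left)
  show "(a + b) *\<^sub>R x = a *\<^sub>R x + b *\<^sub>R x"
    by transfer (simp add: distrib_right flip: fps_const_add)
  show "a *\<^sub>R b *\<^sub>R x = (a * b) *\<^sub>R x"
    by transfer (simp add: mult.assoc flip: fps_const_mult)
  show "1 *\<^sub>R x = x" by transfer simp
  show "x * y * z = x * (y * z)" by transfer (simp add: mult.assoc)
  show "(x + y) * z = x * z + y * z" by transfer (simp add: distrib_right)
  show "x * (y + z) = x * y + x * z" by transfer (simp add: distrib_left)
  show "a *\<^sub>R x * y = a *\<^sub>R (x * y)" by transfer (simp add: mult.assoc)
  show "x * a *\<^sub>R y = a *\<^sub>R (x * y)" by transfer (simp add: mult_ac)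
  show "1 * x = x" "x * 1 = x" by (transfer; simp)+
  show "(0::diamond_series) \<noteq> 1" by transfer simp
  show "dist x y = norm (x - y)" by (rule dist_diamond_series_def)
  show "sgn x = scaleR (inverse (norm x)) x" by (rule sgn_diamond_series_def)
  show "uniformity = (INF e\<in>{0<..}. principal {(x::diamond_series, y). dist x y < e})"
    by (rule uniformity_diamond_series_def)
  show "open U = (\<forall>x\<in>U. \<forall>\<^sub>F (x', y) in uniformity. x' = x \<longrightarrow> y \<in> U)"
    by (rule open_diamond_series_def)
  show "norm x = 0 \<longleftrightarrow> x = 0"
  proof transfer
    fix f assume f: "fps2_summable f"
    show "fps2_norm f = 0 \<longleftrightarrow> f = 0"
    proof
      assume "fps2_norm f = 0"
      then have "\<bar>fps2_nth f x\<bar> * diamond_weight x = 0" for x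
        using f unfolding fps2_norm_def fps2_summable_def
        by (intro nonneg_infsum_le_0D[of "\<lambda>x. \<bar>fps2_nth f x\<bar> * diamond_weight x" UNIV x]) auto
      then have "fps2_nth f x = 0" for x
        using diamond_weight_pos[of x] by (metis abs_eq_0_iff less_irrefl mult_eq_0_iff)
      then show "f = 0" by (intro fps2_eqI) simp
    qed (simp add: fps2_norm_def)
  qed
  show "norm (x + y) \<le> norm x + norm y" by transfer (rule fps2_summable_add)
  show "norm (a *\<^sub>R x) = \<bar>a\<bar> * norm x" by transfer (rule fps2_summable_scale)
  show "norm (x * y) \<le> norm x * norm y" by transfer (rule fps2_summable_mult)
  show "norm (1::diamond_series) = 1"
  proof transfer
    have "fps2_norm 1 = (\<Sum>\<^sub>\<infinity>x. if x = (0::nat, 0::nat) then 1 else 0 :: real)"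
      unfolding fps2_norm_def by (rule infsum_cong) auto
    also have "\<dots> = (\<Sum>\<^sub>\<infinity>x\<in>{(0::nat, 0::nat)}. 1)"
      by (rule infsum_cong_neutral) auto
    finally show "fps2_norm 1 = 1" by simp
  qed
qed

end

text \<open>Commutativity gives a meaning to monomials in several elements of the algebra, which are
  products over an unordered basis.\<close>

instance diamond_series :: comm_ring_1
proof
  fix x y :: diamond_series
  show "x * y = y * x" by transfer (rule mult.commute)
qed (simp_all add: distrib_right)

lift_definition coeff2 :: "diamond_series \<Rightarrow> nat \<times> nat \<Rightarrow> real" is fps2_nth .

lemma coeff2_simps [simp]:
  "coeff2 0 x = 0" "coeff2 1 x = (if x = (0, 0) then 1 else 0)"
  "coeff2 (f + g) x = coeff2 f x + coeff2 g x"
  "coeff2 (f - g) x = coeff2 f x - coeff2 g x"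
  "coeff2 (- f) x = - coeff2 f x"
  "coeff2 (r *\<^sub>R f) x = r * coeff2 f x"
  by (transfer, simp)+

lemma coeff2_mult:
  "coeff2 (f * g) (m, n) = (\<Sum>(i, j)\<in>{..m} \<times> {..n}. coeff2 f (i, j) * coeff2 g (m - i, n - j))"
  by transfer (rule fps2_nth_mult)

lemma norm_diamond_has_sum: "((\<lambda>x. \<bar>coeff2 f x\<bar> * diamond_weight x) has_sum norm f) UNIV"
  by transfer (simp add: fps2_norm_def fps2_summable_def)

text \<open>For a family of infinite norm the value is unspecified; coefficients are read off
  through \<open>coeff2_diamond_of\<close>, which asks for summability.\<close>

definition diamond_of :: "(nat \<times> nat \<Rightarrow> real) \<Rightarrow> diamond_series"
  where "diamond_of c = Abs_diamond_series (Abs_fps (\<lambda>i. Abs_fps (\<lambda>j. c (i, j))))"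

lemma coeff2_diamond_of:
  assumes "(\<lambda>x. \<bar>c x\<bar> * diamond_weight x) summable_on UNIV"
  shows "coeff2 (diamond_of c) = c"
proof -
  have "fps2_nth (Abs_fps (\<lambda>i. Abs_fps (\<lambda>j. c (i, j)))) = c"
    by (auto simp: fps2_nth_def)
  with assms show ?thesis
    unfolding diamond_of_def coeff2.rep_eq by (subst Abs_diamond_series_inverse) (auto simp: fps2_summable_def)
qed

lemma norm_diamond_le:
  assumes "\<And>F. finite F \<Longrightarrow> (\<Sum>x\<in>F. \<bar>coeff2 f x\<bar> * diamond_weight x) \<le> B"
  shows "norm f \<le> B"
  using norm_diamond_has_sum by (rule has_sum_le_finite_sums) (use assms in auto)

lemma sum_coeff2_le_norm:
  "finite F \<Longrightarrow> (\<Sum>x\<in>F. \<bar>coeff2 f x\<bar> * diamond_weight x) \<le> norm f"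
  by (rule finite_sum_le_has_sum[OF norm_diamond_has_sum]) auto

lemma abs_coeff2_le_norm: "\<bar>coeff2 f x\<bar> \<le> norm f / diamond_weight x"
  using sum_coeff2_le_norm[of "{x}" f] diamond_weight_pos[of x] by (simp add: field_simps)

text \<open>Completeness of a weighted l1 space: coefficients converge one by one, since the weight
  of a fixed index is a positive constant, and bounds on finite partial sums survive the
  limit.\<close>

instance diamond_series :: banach
proof
  fix X :: "nat \<Rightarrow> diamond_series"
  assume X: "Cauchy X"
  have "convergent (\<lambda>n. coeff2 (X n) x)" for x
  proof -
    have "Cauchy (\<lambda>n. coeff2 (X n) x)"
    proof (rule metric_CauchyI)
      fix e :: real assume e: "e > 0"
      then obtain M where M: "\<And>m n. m \<ge> M \<Longrightarrow> n \<ge> M \<Longrightarrow> norm (X m - X n) < e * diamond_weight x"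
        using CauchyD[OF X mult_pos_pos[OF e diamond_weight_pos[of x]]] by blast
      have "dist (coeff2 (X m) x) (coeff2 (X n) x) < e" if "m \<ge> M" "n \<ge> M" for m n
        using abs_coeff2_le_norm[of "X m - X n" x] M[OF that] diamond_weight_pos[of x]
        by (simp add: dist_real_def) (smt (verit, best) divide_less_eq)
      then show "\<exists>M. \<forall>m\<ge>M. \<forall>n\<ge>M. dist (coeff2 (X m) x) (coeff2 (X n) x) < e" by blast
    qed
    then show ?thesis by (rule Cauchy_convergent)
  qed
  then obtain c where c: "\<And>x. (\<lambda>n. coeff2 (X n) x) \<longlonglongrightarrow> c x"
    unfolding convergent_def by metis
  \<comment> \<open>\<open>F\<close> is finite because the coefficientwise limit passes through
    finite sums only. Being uniform in \<open>F\<close>, the bound yields both the summability of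
    \<open>c\<close> and the convergence in norm.\<close>
  have close: "(\<Sum>x\<in>F. \<bar>c x - coeff2 (X n) x\<bar> * diamond_weight x) \<le> e"
    if "finite F" "\<And>m. m \<ge> M \<Longrightarrow> norm (X m - X n) < e" for F n M e
  proof (rule tendsto_upperbound)
    show "(\<lambda>m. \<Sum>x\<in>F. \<bar>coeff2 (X m) x - coeff2 (X n) x\<bar> * diamond_weight x)
        \<longlonglongrightarrow> (\<Sum>x\<in>F. \<bar>c x - coeff2 (X n) x\<bar> * diamond_weight x)"
      by (intro tendsto_intros c)
    have "(\<Sum>x\<in>F. \<bar>coeff2 (X m) x - coeff2 (X n) x\<bar> * diamond_weight x) \<le> e" if "m \<ge> M" for m
      using sum_coeff2_le_norm[OF \<open>finite F\<close>, of "X m - X n"] \<open>\<And>m. m \<ge> M \<Longrightarrow> norm (X m - X n) < e\<close>[OF that]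
      by simp
    then show "\<forall>\<^sub>F m in sequentially. (\<Sum>x\<in>F. \<bar>coeff2 (X m) x - coeff2 (X n) x\<bar> * diamond_weight x) \<le> e"
      by (auto simp: eventually_sequentially)
  qed simp
  obtain N where N: "\<And>m. m \<ge> N \<Longrightarrow> norm (X m - X N) < 1"
    using CauchyD[OF X, of 1] by auto
  have "(\<Sum>x\<in>F. \<bar>c x\<bar> * diamond_weight x) \<le> 1 + norm (X N)" if F: "finite F" for F
  proof -
    have "(\<Sum>x\<in>F. \<bar>c x\<bar> * diamond_weight x) \<le>
        (\<Sum>x\<in>F. \<bar>c x - coeff2 (X N) x\<bar> * diamond_weight x + \<bar>coeff2 (X N) x\<bar> * diamond_weight x)"
      by (intro sum_mono) (simp add: distrib_right[symmetric] mult_right_mono)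
    also have "\<dots> \<le> 1 + norm (X N)"
      unfolding sum.distrib using close[OF F N] sum_coeff2_le_norm[OF F] by (rule add_mono)
    finally show ?thesis .
  qed
  then have "(\<lambda>x. \<bar>c x\<bar> * diamond_weight x) summable_on UNIV"
    by (intro nonneg_bdd_above_summable_on) (auto intro!: bdd_aboveI2)
  then have Y: "coeff2 (diamond_of c) = c" by (rule coeff2_diamond_of)
  have "X \<longlonglongrightarrow> diamond_of c"
  proof (rule metric_LIMSEQ_I)
    fix e :: real assume e: "e > 0"
    then obtain M where M: "\<And>m n. m \<ge> M \<Longrightarrow> n \<ge> M \<Longrightarrow> norm (X m - X n) < e / 2"
      using CauchyD[OF X, of "e / 2"] by auto
    have "dist (X n) (diamond_of c) < e" if "n \<ge> M" for n
    proof -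
      have "norm (diamond_of c - X n) \<le> e / 2"
        by (rule norm_diamond_le) (use close[OF _ M] that in \<open>simp add: Y\<close>)
      then show ?thesis using e by (simp add: dist_norm norm_minus_commute)
    qed
    then show "\<exists>M. \<forall>n\<ge>M. dist (X n) (diamond_of c) < e" by blast
  qed
  then show "convergent X" by (rule convergentI)
qed

section \<open>Integration operators and evaluation\<close>

lemma diamond_eqI: "(\<And>i j. coeff2 f (i, j) = coeff2 g (i, j)) \<Longrightarrow> f = g"
  by transfer (rule fps2_eqI)

lemma norm_diamond_of:
  assumes "((\<lambda>x. \<bar>c x\<bar> * diamond_weight x) has_sum s) UNIV"
  shows "norm (diamond_of c) = s"
  using assms norm_diamond_has_sum[of "diamond_of c"] coeff2_diamond_of[of c]
  by (metis has_sum_imp_summable has_sum_unique)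

text \<open>\<open>T x\<close> is the place where a coefficient lands and \<open>S x\<close> the
  place it comes from; if no weighted size grows under the move, the norm does not grow either. Both
  integration operators have this form.\<close>

lemma diamond_of_shift:
  assumes T: "inj T" and S: "inj S" and d0: "\<And>y. y \<notin> range T \<Longrightarrow> d y = 0"
    and le: "\<And>x. \<bar>d (T x)\<bar> * diamond_weight (T x) \<le> \<bar>coeff2 f (S x)\<bar> * diamond_weight (S x)"
  shows "coeff2 (diamond_of d) = d" "norm (diamond_of d) \<le> norm f"
proof -
  let ?c = "\<lambda>x. \<bar>coeff2 f x\<bar> * diamond_weight x" and ?d = "\<lambda>x. \<bar>d x\<bar> * diamond_weight x"
  have c: "?c summable_on UNIV" using norm_diamond_has_sum by (rule has_sum_imp_summable)
  have cS: "(\<lambda>x. ?c (S x)) summable_on UNIV"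
    using summable_on_subset_banach[OF c, of "range S"] summable_on_reindex[OF S, of ?c] by (simp add: o_def)
  have dT: "(\<lambda>x. ?d (T x)) summable_on UNIV"
    by (rule summable_on_comparison_test[OF cS]) (use le in auto)
  have "(?d has_sum infsum (\<lambda>x. ?d (T x)) UNIV) (range T)"
    using has_sum_infsum[OF dT] by (subst has_sum_reindex[OF T]) (simp add: o_def)
  then have dU: "(?d has_sum infsum (\<lambda>x. ?d (T x)) UNIV) UNIV"
    by (rule iffD1[OF has_sum_cong_neutral, rotated -1]) (auto simp: d0)
  then show "coeff2 (diamond_of d) = d"
    by (intro coeff2_diamond_of has_sum_imp_summable)
  have "norm (diamond_of d) = infsum (\<lambda>x. ?d (T x)) UNIV"
    using dU by (rule norm_diamond_of)
  also have "\<dots> \<le> infsum (\<lambda>x. ?c (S x)) UNIV"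
    by (rule infsum_mono[OF dT cS]) (rule le)
  also have "\<dots> = infsum ?c (range S)"
    by (subst infsum_reindex[OF S]) (auto simp: o_def)
  also have "\<dots> \<le> infsum ?c UNIV"
    by (rule infsum_mono_neutral) (use c summable_on_subset_banach[OF c] in auto)
  also have "\<dots> = norm f"
    using norm_diamond_has_sum by (rule infsumI)
  finally show "norm (diamond_of d) \<le> norm f" .
qed

definition t_integral :: "diamond_series \<Rightarrow> diamond_series"
  where "t_integral f = diamond_of (\<lambda>(i, j). if i = 0 then 0 else coeff2 f (i - 1, j) / real i)"

text \<open>Kept as a single operator, because differentiation in x alone is unbounded: the n-th
  power of x has norm 1, and its derivative has norm n. The integration in t compensates for
  this.\<close>

definition x_deriv_t_integral :: "diamond_series \<Rightarrow> diamond_series"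
  where "x_deriv_t_integral f =
    diamond_of (\<lambda>(i, j). if i = 0 then 0 else real (Suc j) * coeff2 f (i - 1, Suc j) / real i)"

text \<open>Written with factorials, the left side is the right side divided by i + j + 1.\<close>

lemma t_integral_weight: "diamond_weight (Suc i, j) / real (Suc i) \<le> diamond_weight (i, j)"
proof -
  have "(i + j) choose i \<le> Suc (i + j) * ((i + j) choose i)" by simp
  also have "\<dots> = Suc i * (Suc (i + j) choose Suc i)" by (rule Suc_times_binomial[symmetric])
  finally have "real ((i + j) choose i) \<le> real (Suc i * (Suc (i + j) choose Suc i))"
    by (subst of_nat_le_iff)
  then have "1 / real (Suc i * (Suc (i + j) choose Suc i)) \<le> 1 / real ((i + j) choose i)"
    by (intro divide_left_mono mult_pos_pos) (auto simp del: binomial_Suc_Suc mult_Suc of_nat_mult)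
  then show ?thesis
    unfolding diamond_weight_def by (simp only: prod.case add_Suc of_nat_mult divide_divide_eq_left mult.commute)
qed

text \<open>Written with factorials, both sides are i! (j + 1)! / (i + j + 1)!. This exact balance,
  due to the preserved total degree, is the reason for the choice of the weight.\<close>

lemma x_deriv_t_integral_weight:
  "real (Suc j) * diamond_weight (Suc i, j) / real (Suc i) = diamond_weight (i, Suc j)"
proof -
  have "Suc i * (Suc (i + j) choose Suc i) = Suc (i + j) * ((i + j) choose i)"
    by (rule Suc_times_binomial)
  also have "\<dots> = Suc j * (Suc (i + j) choose i)"
    using binomial_absorb_comp[of "Suc (i + j)" i] by (simp del: binomial_Suc_Suc mult_Suc)
  finally have "real (Suc i) * real (Suc (i + j) choose Suc i) = real (Suc j) * real (Suc (i + j) choose i)"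
    by (metis of_nat_mult)
  moreover have "(Suc (i + j) choose Suc i) > 0" "(Suc (i + j) choose i) > 0" by simp_all
  ultimately show ?thesis
    unfolding diamond_weight_def prod.case add_Suc add_Suc_right
    by (simp add: field_simps del: of_nat_Suc binomial_Suc_Suc)
qed

lemma coeff2_t_integral:
    "coeff2 (t_integral f) = (\<lambda>(i, j). if i = 0 then 0 else coeff2 f (i - 1, j) / real i)"
  and norm_t_integral_le: "norm (t_integral f) \<le> norm f"
proof -
  let ?T = "\<lambda>(i, j). (Suc i, j :: nat)" and ?d = "\<lambda>(i, j). if i = 0 then 0 else coeff2 f (i - 1, j) / real i"
  have T: "inj ?T" by (auto simp: inj_on_def)
  have 1: "y \<notin> range ?T \<Longrightarrow> ?d y = 0" for y
    by (auto simp: image_iff gr0_conv_Suc split: prod.splits)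
  have 2: "\<bar>?d (?T x)\<bar> * diamond_weight (?T x) \<le> \<bar>coeff2 f x\<bar> * diamond_weight x" for x
  proof -
    obtain i j where x: "x = (i, j)" by force
    show ?thesis
      using mult_left_mono[OF t_integral_weight[of i j], of "\<bar>coeff2 f x\<bar>"] by (simp add: x)
  qed
  show "coeff2 (t_integral f) = ?d" "norm (t_integral f) \<le> norm f"
    using diamond_of_shift[of ?T id ?d f] T 1 2 unfolding t_integral_def by simp_all
qed

lemma coeff2_x_deriv_t_integral:
    "coeff2 (x_deriv_t_integral f) =
      (\<lambda>(i, j). if i = 0 then 0 else real (Suc j) * coeff2 f (i - 1, Suc j) / real i)"
  and norm_x_deriv_t_integral_le: "norm (x_deriv_t_integral f) \<le> norm f"
proof -
  let ?T = "\<lambda>(i, j). (Suc i, j :: nat)" and ?S = "\<lambda>(i, j). (i :: nat, Suc j)"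
    and ?d = "\<lambda>(i, j). if i = 0 then 0 else real (Suc j) * coeff2 f (i - 1, Suc j) / real i"
  have T: "inj ?T" "inj ?S" by (auto simp: inj_on_def)
  have 1: "y \<notin> range ?T \<Longrightarrow> ?d y = 0" for y
    by (auto simp: image_iff gr0_conv_Suc split: prod.splits)
  have 2: "\<bar>?d (?T x)\<bar> * diamond_weight (?T x) \<le> \<bar>coeff2 f (?S x)\<bar> * diamond_weight (?S x)" for x
  proof -
    obtain i j where x: "x = (i, j)" by force
    have "\<bar>?d (?T x)\<bar> * diamond_weight (?T x) =
        \<bar>coeff2 f (?S x)\<bar> * (real (Suc j) * diamond_weight (Suc i, j) / real (Suc i))"
      by (simp add: x abs_mult mult_ac)
    then show ?thesis
      unfolding x_deriv_t_integral_weight by (simp add: x)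
  qed
  show "coeff2 (x_deriv_t_integral f) = ?d" "norm (x_deriv_t_integral f) \<le> norm f"
    using diamond_of_shift[of ?T ?S ?d f] T 1 2 unfolding x_deriv_t_integral_def by simp_all
qed

lemma bounded_linear_t_integral: "bounded_linear t_integral"
  by (rule bounded_linear_intro[where K=1])
    (auto intro!: diamond_eqI simp: coeff2_t_integral norm_t_integral_le add_divide_distrib)

lemma bounded_linear_x_deriv_t_integral: "bounded_linear x_deriv_t_integral"
  by (rule bounded_linear_intro[where K=1])
    (auto intro!: diamond_eqI simp: coeff2_x_deriv_t_integral norm_x_deriv_t_integral_le
      add_divide_distrib distrib_left)

section \<open>Evaluation of double series on the unit diamond\<close>

definition series2 :: "(nat \<times> nat \<Rightarrow> real) \<Rightarrow> real \<Rightarrow> real \<Rightarrow> real"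
  where "series2 a t x = (\<Sum>\<^sub>\<infinity>(i, j). a (i, j) * t ^ i * x ^ j)"

text \<open>Absolute convergence at each point, without uniformity. For open \<open>W\<close> this
  suffices, since each point is dominated by a point of \<open>W\<close> with larger absolute
  coordinates.\<close>

definition convergent2 :: "(nat \<times> nat \<Rightarrow> real) \<Rightarrow> (real \<times> real) set \<Rightarrow> bool"
  where "convergent2 a W \<longleftrightarrow>
    (\<forall>(t, x)\<in>W. (\<lambda>(i, j). \<bar>a (i, j)\<bar> * \<bar>t\<bar> ^ i * \<bar>x\<bar> ^ j) summable_on UNIV)"

lemma convergent2D:
  assumes "convergent2 a W" "(t, x) \<in> W"
  shows "(\<lambda>(i, j). \<bar>a (i, j)\<bar> * \<bar>t\<bar> ^ i * \<bar>x\<bar> ^ j) summable_on UNIV"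
    "((\<lambda>(i, j). a (i, j) * t ^ i * x ^ j) has_sum series2 a t x) UNIV"
proof -
  show *: "(\<lambda>(i, j). \<bar>a (i, j)\<bar> * \<bar>t\<bar> ^ i * \<bar>x\<bar> ^ j) summable_on UNIV"
    using assms by (auto simp: convergent2_def)
  have "(\<lambda>(i, j). a (i, j) * t ^ i * x ^ j) summable_on UNIV"
    by (rule abs_summable_summable) (use * in \<open>simp add: case_prod_unfold abs_mult power_abs\<close>)
  then show "((\<lambda>(i, j). a (i, j) * t ^ i * x ^ j) has_sum series2 a t x) UNIV"
    unfolding series2_def by (rule has_sum_infsum)
qed

definition diamond :: "real \<Rightarrow> real \<Rightarrow> (real \<times> real) set"
  where "diamond \<tau> r = {(t, x). \<bar>t\<bar> / \<tau> + \<bar>x\<bar> / r < 1}"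

text \<open>Multiplied by \<open>(i + j) choose i\<close>, the left side is one term of the binomial
  expansion of (|t| + |x|)^(i + j), which is at most 1.\<close>

lemma diamond_weight_ge:
  fixes t x :: real
  assumes "\<bar>t\<bar> + \<bar>x\<bar> \<le> 1"
  shows "\<bar>t\<bar> ^ i * \<bar>x\<bar> ^ j \<le> diamond_weight (i, j)"
proof -
  have "real ((i + j) choose i) * \<bar>t\<bar> ^ i * \<bar>x\<bar> ^ (i + j - i) \<le>
      (\<Sum>k\<le>i + j. real ((i + j) choose k) * \<bar>t\<bar> ^ k * \<bar>x\<bar> ^ (i + j - k))"
    by (rule member_le_sum) auto
  also have "\<dots> = (\<bar>t\<bar> + \<bar>x\<bar>) ^ (i + j)"
    by (rule binomial_ring[symmetric])
  also have "\<dots> \<le> 1"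
    using assms by (intro power_le_one) auto
  finally show ?thesis
    by (simp add: diamond_weight_def field_simps)
qed

lemma convergent2_coeff2: "convergent2 (coeff2 f) (diamond 1 1)"
  unfolding convergent2_def
proof (clarify)
  fix t x :: real assume "(t, x) \<in> diamond 1 1"
  then have "\<bar>t\<bar> + \<bar>x\<bar> \<le> 1" by (simp add: diamond_def)
  then have "\<bar>coeff2 f (i, j)\<bar> * (\<bar>t\<bar> ^ i * \<bar>x\<bar> ^ j) \<le> \<bar>coeff2 f (i, j)\<bar> * diamond_weight (i, j)" for i j
    by (intro mult_left_mono diamond_weight_ge) auto
  then show "(\<lambda>(i, j). \<bar>coeff2 f (i, j)\<bar> * \<bar>t\<bar> ^ i * \<bar>x\<bar> ^ j) summable_on UNIV"
    by (intro summable_on_comparison_test[OF has_sum_imp_summable[OF norm_diamond_has_sum[of f]]])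
      (auto simp: mult.assoc)
qed

definition ev2 :: "real \<times> real \<Rightarrow> diamond_series \<Rightarrow> real"
  where "ev2 p f = series2 (coeff2 f) (fst p) (snd p)"

context
  fixes p :: "real \<times> real"
  assumes p: "p \<in> diamond 1 1"
begin

lemma ev2_has_sum: "((\<lambda>(i, j). coeff2 f (i, j) * fst p ^ i * snd p ^ j) has_sum ev2 p f) UNIV"
  unfolding ev2_def using convergent2D(2)[OF convergent2_coeff2, of "fst p" "snd p"] p by simp

lemma ev2_eqI: "((\<lambda>(i, j). coeff2 f (i, j) * fst p ^ i * snd p ^ j) has_sum s) UNIV \<Longrightarrow> ev2 p f = s"
  using ev2_has_sum has_sum_unique by blast

lemma abs_ev2_le: "\<bar>ev2 p f\<bar> \<le> norm f"
  unfolding real_norm_def[symmetric]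
proof (rule norm_infsum_le[OF ev2_has_sum norm_diamond_has_sum], clarify)
  fix i j
  have "\<bar>coeff2 f (i, j)\<bar> * (\<bar>fst p\<bar> ^ i * \<bar>snd p\<bar> ^ j) \<le> \<bar>coeff2 f (i, j)\<bar> * diamond_weight (i, j)"
    using p by (intro mult_left_mono diamond_weight_ge) (auto simp: diamond_def)
  then show "norm (coeff2 f (i, j) * fst p ^ i * snd p ^ j) \<le> \<bar>coeff2 f (i, j)\<bar> * diamond_weight (i, j)"
    by (simp add: abs_mult power_abs mult.assoc)
qed

lemma bounded_linear_ev2: "bounded_linear (ev2 p)"
proof (rule bounded_linear_intro[where K=1])
  show "ev2 p (f + g) = ev2 p f + ev2 p g" for f g
    using has_sum_add[OF ev2_has_sum[of f] ev2_has_sum[of g]]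
    by (intro ev2_eqI) (simp add: case_prod_unfold algebra_simps)
  show "ev2 p (r *\<^sub>R f) = r *\<^sub>R ev2 p f" for r f
    using has_sum_cmult_right[OF ev2_has_sum[of f], of r]
    by (intro ev2_eqI) (simp add: case_prod_unfold algebra_simps)
  show "norm (ev2 p f) \<le> norm f * 1" for f
    using abs_ev2_le by simp
qed

lemma ev2_one [simp]: "ev2 p 1 = 1"
  by (rule ev2_eqI, rule has_sum_finite_neutralI[of "{(0, 0)}"]) (auto split: if_splits)

text \<open>Absolute convergence on the diamond justifies multiplying out and regrouping. With
  linearity, this is what carries equations between series over to equations between
  functions.\<close>

lemma ev2_mult [simp]: "ev2 p (f * g) = ev2 p f * ev2 p g"
proof (rule ev2_eqI)
  let ?F = "\<lambda>(i, j). coeff2 f (i, j) * fst p ^ i * snd p ^ j"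
    and ?G = "\<lambda>(i, j). coeff2 g (i, j) * fst p ^ i * snd p ^ j"
  have F: "(?F has_sum ev2 p f) UNIV" and G: "(?G has_sum ev2 p g) UNIV" by (rule ev2_has_sum)+
  have abs: "(\<lambda>x. \<bar>?F x\<bar>) summable_on UNIV" "(\<lambda>x. \<bar>?G x\<bar>) summable_on UNIV"
    using has_sum_imp_summable[OF F, THEN iffD1[OF summable_on_iff_abs_summable_on_real]]
      has_sum_imp_summable[OF G, THEN iffD1[OF summable_on_iff_abs_summable_on_real]]
    by simp_all
  have "(\<lambda>(x, y). \<bar>?F x\<bar> * \<bar>?G y\<bar>) summable_on UNIV \<times> UNIV"
    by (rule summable_on_Times_mult) (use abs in auto)
  then have sm: "(\<lambda>(x, y). ?F x * ?G y) summable_on UNIV \<times> UNIV"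
    by - (rule abs_summable_summable, simp add: case_prod_unfold abs_mult)
  have "infsum (\<lambda>(x, y). ?F x * ?G y) (UNIV \<times> UNIV) = ev2 p f * ev2 p g"
    using infsum_Sigma'_banach[OF sm] infsumI[OF F] infsumI[OF G]
    by (simp add: infsum_cmult_right' infsum_cmult_left')
  then have "((\<lambda>(x, y). ?F x * ?G y) has_sum ev2 p f * ev2 p g) (UNIV \<times> UNIV)"
    using has_sum_infsum[OF sm] by simp
  then have "((\<lambda>(m, n). \<Sum>(i, j)\<in>{..m} \<times> {..n}. ?F (i, j) * ?G (m - i, n - j)) has_sum ev2 p f * ev2 p g) UNIV"
    using has_sum_cauchy_product2[of "\<lambda>x y. ?F x * ?G y"] by (simp only: case_prod_unfold prod.collapse)
  moreover have "(\<Sum>(i, j)\<in>{..m} \<times> {..n}. ?F (i, j) * ?G (m - i, n - j)) =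
      coeff2 (f * g) (m, n) * fst p ^ m * snd p ^ n" for m n
  proof -
    have "coeff2 f (i, j) * fst p ^ i * snd p ^ j * (coeff2 g (m - i, n - j) * fst p ^ (m - i) * snd p ^ (n - j)) =
         coeff2 f (i, j) * coeff2 g (m - i, n - j) * (fst p ^ m * snd p ^ n)" if "i \<le> m" "j \<le> n" for i j
    proof -
      have "fst p ^ m = fst p ^ i * fst p ^ (m - i)" "snd p ^ n = snd p ^ j * snd p ^ (n - j)"
        using that by (simp_all flip: power_add)
      then show ?thesis by simp
    qed
    then show ?thesis
      unfolding coeff2_mult mult.assoc[of _ "fst p ^ m"] sum_distrib_right
      by (intro sum.cong refl) auto
  qed
  ultimately show "((\<lambda>(m, n). coeff2 (f * g) (m, n) * fst p ^ m * snd p ^ n) has_sum ev2 p f * ev2 p g) UNIV"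
    by simp
qed

lemma ev2_power [simp]: "ev2 p (f ^ n) = ev2 p f ^ n"
  by (induction n) simp_all

lemma ev2_prod: "ev2 p (\<Prod>b\<in>B. F b) = (\<Prod>b\<in>B. ev2 p (F b))"
  by (induction B rule: infinite_finite_induct) simp_all

lemma ev2_linear [simp]:
  "ev2 p (f + g) = ev2 p f + ev2 p g" "ev2 p (f - g) = ev2 p f - ev2 p g"
  "ev2 p (r *\<^sub>R f) = r * ev2 p f"
proof -
  interpret bounded_linear "ev2 p" by (rule bounded_linear_ev2)
  show "ev2 p (f + g) = ev2 p f + ev2 p g" "ev2 p (f - g) = ev2 p f - ev2 p g"
    "ev2 p (r *\<^sub>R f) = r * ev2 p f"
    by (simp_all add: add diff scale)
qed

lemma ev2_t_integral_0: "fst p = 0 \<Longrightarrow> ev2 p (t_integral f) = 0"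
  by (rule ev2_eqI) (auto simp: coeff2_t_integral power_0_left intro!: has_sum_0)

end

section \<open>Series in x alone and the time variable as elements of the algebra\<close>

definition x_series :: "(nat \<Rightarrow> real) \<Rightarrow> diamond_series"
  where "x_series a = diamond_of (\<lambda>(i, j). if i = 0 then a j else 0)"

text \<open>The weight is 1 on the axis i = 0, so on series in x alone the norm is the plain l1 norm
  of the coefficients.\<close>

lemma
  assumes "((\<lambda>j. \<bar>a j\<bar>) has_sum s) UNIV"
  shows coeff2_x_series: "coeff2 (x_series a) = (\<lambda>(i, j). if i = 0 then a j else 0)"
    and norm_x_series: "norm (x_series a) = s"
proof -
  let ?c = "\<lambda>(i, j). if i = 0 then a j else (0::real)"
  have inj: "inj (Pair (0::nat) :: nat \<Rightarrow> _)" by (auto simp: inj_on_def)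
  have "((\<lambda>x. \<bar>?c x\<bar> * diamond_weight x) has_sum s) (range (Pair 0))"
    using assms by (subst has_sum_reindex[OF inj]) (simp add: o_def)
  then have "((\<lambda>x. \<bar>?c x\<bar> * diamond_weight x) has_sum s) UNIV"
    by (subst has_sum_cong_neutral[where T="range (Pair 0)" and g="\<lambda>x. \<bar>?c x\<bar> * diamond_weight x"]) auto
  then show "coeff2 (x_series a) = ?c" "norm (x_series a) = s"
    unfolding x_series_def by (auto intro!: coeff2_diamond_of norm_diamond_of dest: has_sum_imp_summable)
qed

lemma ev2_x_series:
  assumes p: "p \<in> diamond 1 1" and a: "(\<lambda>j. \<bar>a j\<bar>) summable_on UNIV"
    and s: "((\<lambda>j. a j * snd p ^ j) has_sum s) UNIV"
  shows "ev2 p (x_series a) = s"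
proof (rule ev2_eqI[OF p])
  let ?c = "\<lambda>(i, j). coeff2 (x_series a) (i, j) * fst p ^ i * snd p ^ j"
  have inj: "inj (Pair (0::nat) :: nat \<Rightarrow> _)" by (auto simp: inj_on_def)
  have c: "coeff2 (x_series a) = (\<lambda>(i, j). if i = 0 then a j else 0)"
    by (rule coeff2_x_series) (rule has_sum_infsum[OF a])
  have "(?c has_sum s) (range (Pair 0))"
    using s by (subst has_sum_reindex[OF inj]) (simp add: o_def c)
  then show "(?c has_sum s) UNIV"
    by (subst has_sum_cong_neutral[where T="range (Pair 0)" and g="?c"]) (auto simp: c)
qed

definition t_var :: diamond_series
  where "t_var = diamond_of (\<lambda>x. if x = (1, 0) then 1 else 0)"

lemma coeff2_t_var: "coeff2 t_var = (\<lambda>x. if x = (1, 0) then 1 else 0)"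
  and norm_t_var: "norm t_var = 1"
proof -
  have "((\<lambda>x. \<bar>if x = (1, 0) then 1 else 0 :: real\<bar> * diamond_weight x) has_sum 1) UNIV"
    by (rule has_sum_finite_neutralI[of "{(1, 0)}"]) auto
  then show "coeff2 t_var = (\<lambda>x. if x = (1, 0) then 1 else 0)" "norm t_var = 1"
    unfolding t_var_def by (auto intro!: coeff2_diamond_of norm_diamond_of dest: has_sum_imp_summable)
qed

lemma ev2_t_var: "p \<in> diamond 1 1 \<Longrightarrow> ev2 p t_var = fst p"
  by (rule ev2_eqI, assumption, rule has_sum_finite_neutralI[of "{(1, 0)}"]) (auto simp: coeff2_t_var split: if_splits)

section \<open>Differentiation and re-expansion of double power series\<close>

text \<open>Convergence at a point with larger absolute coordinates pays for derivatives and for a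
  change of centre. The point \<open>(t', x)\<close>, with only the time enlarged, serves
  differentiation in t at fixed x.\<close>

lemma open_enlarge:
  fixes W :: "(real \<times> real) set"
  assumes "open W" "(t, x) \<in> W"
  obtains \<delta> t' x' where "\<delta> > 0" "\<bar>t'\<bar> = \<bar>t\<bar> + \<delta>" "\<bar>x'\<bar> = \<bar>x\<bar> + \<delta>" "(t', x') \<in> W" "(t', x) \<in> W"
proof -
  obtain e where e: "e > 0" "ball (t, x) e \<subseteq> W"
    using assms open_contains_ball by blast
  \<comment> \<open>Moving by \<delta> in the direction \<open>sg\<close> enlarges the absolute
    value; the value at 0 is 1, so that zero coordinates move as well. With \<delta> = e / 3 the
    displacement is at most 2 e / 3, hence inside the ball.\<close>
  define sg :: "real \<Rightarrow> real" where "sg u = (if u \<ge> 0 then 1 else - 1)" for u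
  define \<delta> where "\<delta> = e / 3"
  have "\<delta> > 0" using e by (simp add: \<delta>_def)
  have sg: "\<bar>u + sg u * \<delta>\<bar> = \<bar>u\<bar> + \<delta>" "\<bar>sg u * \<delta>\<bar> = \<delta>" for u
    using e by (auto simp: sg_def \<delta>_def abs_if)
  have "(t + sg t * \<delta>, x + sg x * \<delta>) \<in> ball (t, x) e" "(t + sg t * \<delta>, x) \<in> ball (t, x) e"
    using sqrt_sum_squares_le_sum[of \<delta> \<delta>] e sg(2)[of t] sg(2)[of x]
    by (auto simp: dist_Pair_Pair dist_real_def \<delta>_def)
  then show thesis
    using e(2) \<open>\<delta> > 0\<close> by (intro that[of \<delta> "t + sg t * \<delta>" "x + sg x * \<delta>"]) (auto simp only: sg)
qed

definition t_deriv_coeffs :: "(nat \<times> nat \<Rightarrow> real) \<Rightarrow> nat \<times> nat \<Rightarrow> real"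
  where "t_deriv_coeffs a = (\<lambda>(i, j). real (Suc i) * a (Suc i, j))"

definition x_deriv_coeffs :: "(nat \<times> nat \<Rightarrow> real) \<Rightarrow> nat \<times> nat \<Rightarrow> real"
  where "x_deriv_coeffs a = (\<lambda>(i, j). real (Suc j) * a (i, Suc j))"

text \<open>The left side is one term of the binomial expansion of the right side. The factor
  \<open>Suc i\<close> produced by differentiation is thus absorbed by a slightly larger
  radius.\<close>

lemma Suc_mult_power_le:
  fixes u \<delta> :: real
  assumes "u \<ge> 0" "\<delta> \<ge> 0"
  shows "real (Suc i) * u ^ i * \<delta> \<le> (u + \<delta>) ^ Suc i"
proof (induction i)
  case (Suc i)
  have "real (Suc (Suc i)) * u ^ Suc i * \<delta> = u * (real (Suc i) * u ^ i * \<delta>) + \<delta> * u ^ Suc i"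
    by (simp add: algebra_simps)
  also have "\<dots> \<le> u * (u + \<delta>) ^ Suc i + \<delta> * (u + \<delta>) ^ Suc i"
    using assms Suc by (intro add_mono mult_left_mono power_mono) auto
  finally show ?case by (simp add: algebra_simps)
qed (use assms in simp)

lemma convergent2_t_deriv:
  assumes W: "open W" and a: "convergent2 a W"
  shows "convergent2 (t_deriv_coeffs a) W"
  unfolding convergent2_def
proof clarify
  fix t x assume tx: "(t, x) \<in> W"
  obtain \<delta> t' where d: "\<delta> > 0" "\<bar>t'\<bar> = \<bar>t\<bar> + \<delta>" "(t', x) \<in> W"
    using open_enlarge[OF W tx] by metis
  let ?T = "\<lambda>(i, j). (Suc i, j :: nat)" and ?f = "\<lambda>(i, j). \<bar>a (i, j)\<bar> * \<bar>t'\<bar> ^ i * \<bar>x\<bar> ^ j"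
  have T: "inj ?T" by (auto simp: inj_on_def)
  have "?f summable_on range ?T"
    using summable_on_subset_banach[OF convergent2D(1)[OF a d(3)]] by blast
  then have "(\<lambda>(i, j). \<bar>a (Suc i, j)\<bar> * \<bar>t'\<bar> ^ Suc i * \<bar>x\<bar> ^ j) summable_on UNIV"
    using summable_on_reindex[OF T, of ?f] by (simp add: o_def case_prod_unfold)
  then have "(\<lambda>z. (case z of (i, j) \<Rightarrow> \<bar>a (Suc i, j)\<bar> * \<bar>t'\<bar> ^ Suc i * \<bar>x\<bar> ^ j) * (1 / \<delta>)) summable_on UNIV"
    by (rule summable_on_cmult_left)
  then show "(\<lambda>(i, j). \<bar>t_deriv_coeffs a (i, j)\<bar> * \<bar>t\<bar> ^ i * \<bar>x\<bar> ^ j) summable_on UNIV"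
  proof (rule summable_on_comparison_test; clarsimp simp: t_deriv_coeffs_def abs_mult)
    fix i j
    have "real (Suc i) * \<bar>t\<bar> ^ i \<le> \<bar>t'\<bar> ^ Suc i / \<delta>"
      using Suc_mult_power_le[of "\<bar>t\<bar>" \<delta> i] d by (simp add: field_simps)
    then have "\<bar>a (Suc i, j)\<bar> * \<bar>x\<bar> ^ j * (real (Suc i) * \<bar>t\<bar> ^ i) \<le> \<bar>a (Suc i, j)\<bar> * \<bar>x\<bar> ^ j * (\<bar>t'\<bar> ^ Suc i / \<delta>)"
      by (rule mult_left_mono) auto
    then show "(1 + real i) * \<bar>a (Suc i, j)\<bar> * \<bar>t\<bar> ^ i * \<bar>x\<bar> ^ j \<le> \<bar>a (Suc i, j)\<bar> * (\<bar>t'\<bar> * \<bar>t'\<bar> ^ i) * \<bar>x\<bar> ^ j / \<delta>"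
      by (simp add: mult_ac)
  qed
qed

lemma series2_sums_rows:
  fixes a :: "nat \<times> nat \<Rightarrow> real"
  assumes "((\<lambda>(i, j). a (i, j) * s ^ i * x ^ j) has_sum S) UNIV"
    and "\<And>i. ((\<lambda>j. a (i, j) * x ^ j) has_sum b i) UNIV"
  shows "(\<lambda>i. b i * s ^ i) sums S"
proof (rule has_sum_imp_sums)
  have "((\<lambda>(i, j). a (i, j) * s ^ i * x ^ j) has_sum S) (SIGMA i:UNIV. UNIV)"
    using assms(1) by simp
  then show "((\<lambda>i. b i * s ^ i) has_sum S) UNIV"
  proof (rule has_sum_SigmaD)
    fix i
    show "((\<lambda>j. case (i, j) of (i, j) \<Rightarrow> a (i, j) * s ^ i * x ^ j) has_sum b i * s ^ i) UNIV"
      using has_sum_cmult_left[OF assms(2)[of i], of "s ^ i"] by (simp add: mult_ac)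
  qed
qed

text \<open>At fixed x the rows are summed first. This gives an ordinary power series in time, to
  which termwise differentiation in one variable applies.\<close>

lemma series2_t_deriv:
  assumes W: "open W" and a: "convergent2 a W" and tx: "(t, x) \<in> W"
  shows "((\<lambda>s. series2 a s x) has_real_derivative series2 (t_deriv_coeffs a) t x) (at t)"
proof -
  obtain \<delta> t' where d: "\<delta> > 0" "\<bar>t'\<bar> = \<bar>t\<bar> + \<delta>" "(t', x) \<in> W"
    using open_enlarge[OF W tx] by metis
  then have t': "t' \<noteq> 0" "\<bar>t\<bar> < \<bar>t'\<bar>" by auto
  define b where "b i = (\<Sum>\<^sub>\<infinity>j. a (i, j) * x ^ j)" for i
  \<comment> \<open>Each row converges because the row of the full series at \<open>t'\<close> can
    be divided by \<open>t' ^ i\<close>; as an enlarged point, \<open>t'\<close> is nonzero even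
    when \<open>t\<close> is 0.\<close>
  have b: "((\<lambda>j. a (i, j) * x ^ j) has_sum b i) UNIV" for i
    unfolding b_def
  proof (rule has_sum_infsum)
    have "(\<lambda>(i, j). a (i, j) * t' ^ i * x ^ j) summable_on (SIGMA i:UNIV. UNIV)"
      using convergent2D(2)[OF a d(3)] by (auto dest: has_sum_imp_summable)
    then have "(\<lambda>j. a (i, j) * t' ^ i * x ^ j) summable_on UNIV"
      by (rule summable_on_SigmaD1) simp
    then have "(\<lambda>j. a (i, j) * t' ^ i * x ^ j * (1 / t' ^ i)) summable_on UNIV"
      by (rule summable_on_cmult_left)
    then show "(\<lambda>j. a (i, j) * x ^ j) summable_on UNIV"
      using t' by (simp add: mult_ac)
  qed
  have sums: "(\<lambda>i. b i * s ^ i) sums series2 a s x" if s: "\<bar>s\<bar> \<le> \<bar>t'\<bar>" for s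
  proof (rule series2_sums_rows[OF _ b])
    have "convergent2 a {(s, x)}"
      unfolding convergent2_def
    proof clarify
      show "(\<lambda>(i, j). \<bar>a (i, j)\<bar> * \<bar>s\<bar> ^ i * \<bar>x\<bar> ^ j) summable_on UNIV"
        by (rule summable_on_comparison_test[OF convergent2D(1)[OF a d(3)]])
          (use s in \<open>auto intro!: mult_mono power_mono\<close>)
    qed
    then show "((\<lambda>(i, j). a (i, j) * s ^ i * x ^ j) has_sum series2 a s x) UNIV"
      by (rule convergent2D) simp
  qed
  have dsums: "(\<lambda>i. diffs b i * t ^ i) sums series2 (t_deriv_coeffs a) t x"
  proof (rule series2_sums_rows)
    show "((\<lambda>(i, j). t_deriv_coeffs a (i, j) * t ^ i * x ^ j) has_sum series2 (t_deriv_coeffs a) t x) UNIV"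
      using convergent2D(2)[OF convergent2_t_deriv[OF W a] tx] .
    show "((\<lambda>j. t_deriv_coeffs a (i, j) * x ^ j) has_sum diffs b i) UNIV" for i
      using has_sum_cmult_right[OF b[of "Suc i"], of "real (Suc i)"]
      by (simp add: t_deriv_coeffs_def diffs_def mult_ac del: of_nat_Suc)
  qed
  have "((\<lambda>s. \<Sum>n. b n * s ^ n) has_real_derivative (\<Sum>n. diffs b n * t ^ n)) (at t)"
    by (rule termdiffs_strong[of _ t']) (use sums[of t'] t' in \<open>auto dest: sums_summable\<close>)
  also have "(\<Sum>n. diffs b n * t ^ n) = series2 (t_deriv_coeffs a) t x"
    using dsums by (rule sums_unique[symmetric])
  finally show ?thesis
    by (rule has_field_derivative_transform_within_open[where S="{- \<bar>t'\<bar><..<\<bar>t'\<bar>}"])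
      (use t' sums in \<open>auto intro!: sums_unique[symmetric] simp: abs_less_iff abs_le_iff\<close>)
qed

lemma series2_swap: "series2 a t x = series2 (a \<circ> prod.swap) x t"
  unfolding series2_def
  by (rule infsum_reindex_bij_witness[of _ prod.swap prod.swap]) (auto simp: mult_ac)

lemma convergent2_swap: "convergent2 (a \<circ> prod.swap) (prod.swap ` W) \<longleftrightarrow> convergent2 a W"
proof -
  have "(\<lambda>(i, j). \<bar>(a \<circ> prod.swap) (i, j)\<bar> * \<bar>x\<bar> ^ i * \<bar>t\<bar> ^ j) summable_on UNIV \<longleftrightarrow>
      (\<lambda>(i, j). \<bar>a (i, j)\<bar> * \<bar>t\<bar> ^ i * \<bar>x\<bar> ^ j) summable_on UNIV" for t x :: real
    by (rule summable_on_reindex_bij_witness[of _ prod.swap prod.swap]) (auto simp: mult_ac)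
  then show ?thesis
    by (auto simp: convergent2_def)
qed

text \<open>Exchanging the two variables by \<open>prod.swap\<close> transfers the results on
  t-derivatives.\<close>

lemma
  assumes W: "open W" and a: "convergent2 a W"
  shows convergent2_x_deriv: "convergent2 (x_deriv_coeffs a) W"
    and series2_x_deriv: "(t, x) \<in> W \<Longrightarrow>
      ((\<lambda>s. series2 a t s) has_real_derivative series2 (x_deriv_coeffs a) t x) (at x)"
proof -
  have "prod.swap ` W = prod.swap -` W"
    by (auto intro: image_eqI[where x="prod.swap y" for y])
  then have W': "open (prod.swap ` W)"
    using open_vimage[OF W, of prod.swap] by (simp add: continuous_on_swap)
  have a': "convergent2 (a \<circ> prod.swap) (prod.swap ` W)"
    using a by (simp add: convergent2_swap)
  have sw: "t_deriv_coeffs (a \<circ> prod.swap) = x_deriv_coeffs a \<circ> prod.swap"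
    by (auto simp: t_deriv_coeffs_def x_deriv_coeffs_def)
  show "convergent2 (x_deriv_coeffs a) W"
    using convergent2_t_deriv[OF W' a'] by (simp add: sw convergent2_swap)
  show "((\<lambda>s. series2 a t s) has_real_derivative series2 (x_deriv_coeffs a) t x) (at x)" if "(t, x) \<in> W"
    using series2_t_deriv[OF W' a', of x t] that
    by (simp add: sw series2_swap[of _ t] image_iff Bex_def)
qed

lemma partial_t_series2:
  "open W \<Longrightarrow> convergent2 a W \<Longrightarrow> (t, x) \<in> W \<Longrightarrow>
    ((\<lambda>s. series2 a s x) has_vector_derivative series2 (t_deriv_coeffs a) t x) (at t)"
  using series2_t_deriv by (metis has_real_derivative_iff_has_vector_derivative)

lemma partial_x_series2:
  "open W \<Longrightarrow> convergent2 a W \<Longrightarrow> (t, x) \<in> W \<Longrightarrow>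
    ((\<lambda>s. series2 a t s) has_vector_derivative series2 (x_deriv_coeffs a) t x) (at x)"
  using series2_x_deriv by (metis has_real_derivative_iff_has_vector_derivative)

text \<open>\<open>(s + t) ^ i * (u + x) ^ j\<close> is expanded by the binomial theorem and
  regrouped by the exponents of \<open>s\<close> and \<open>u\<close>. This is legitimate because
  the same expansion with absolute values adds up to the series assumed to converge.\<close>

lemma convergent2_abs_shift:
  assumes "(\<lambda>(i, j). \<bar>a (i, j)\<bar> * (\<bar>t\<bar> + \<bar>s\<bar>) ^ i * (\<bar>x\<bar> + \<bar>u\<bar>) ^ j) summable_on UNIV"
  shows "(\<lambda>((k, l), (m, n)). a (k + m, l + n) * real ((k + m) choose k) * real ((l + n) choose l)
      * t ^ m * s ^ k * x ^ n * u ^ l) summable_on UNIV \<times> UNIV" (is ?thesis1)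
    and "((\<lambda>(i, j). a (i, j) * (s + t) ^ i * (u + x) ^ j) has_sum S) UNIV \<Longrightarrow>
      ((\<lambda>((k, l), (m, n)). a (k + m, l + n) * real ((k + m) choose k) * real ((l + n) choose l)
      * t ^ m * s ^ k * x ^ n * u ^ l) has_sum S) (UNIV \<times> UNIV)" (is "_ \<Longrightarrow> ?thesis2")
proof -
  let ?S = "SIGMA ij:(UNIV :: (nat \<times> nat) set). {..fst ij} \<times> {..snd ij}"
  let ?F = "\<lambda>a t s x u ((i, j), (k, l)). a (i, j) * (real (i choose k) * s ^ k * t ^ (i - k)) *
      (real (j choose l) * u ^ l * x ^ (j - l)) :: real"
  let ?G = "\<lambda>((k, l), (m, n)). a (k + m, l + n) * real ((k + m) choose k) * real ((l + n) choose l)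
      * t ^ m * s ^ k * x ^ n * u ^ l"
  \<comment> \<open>All parameters are left free, since the identity is used once with absolute
    values, for summability, and once with the given data, for the value of the sum.\<close>
  have inner: "((\<lambda>kl. ?F a t s x u (ij, kl)) has_sum (case ij of (i, j) \<Rightarrow> a (i, j) * (s + t) ^ i * (u + x) ^ j))
      ({..fst ij} \<times> {..snd ij})" for ij and a :: "nat \<times> nat \<Rightarrow> real" and t s x u
  proof -
    obtain i j where ij: "ij = (i, j)" by force
    have "(\<Sum>kl\<in>{..i} \<times> {..j}. ?F a t s x u ((i, j), kl)) = a (i, j) * (s + t) ^ i * (u + x) ^ j"
      unfolding binomial_ring mult.assoc sum_product
      by (simp add: sum_distrib_left sum.cartesian_product case_prod_unfold)
    then show ?thesis
      unfolding ij by (intro has_sum_finiteI) auto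
  qed
  have "(\<lambda>z. ?F (\<lambda>x. \<bar>a x\<bar>) \<bar>t\<bar> \<bar>s\<bar> \<bar>x\<bar> \<bar>u\<bar> z) summable_on ?S"
    by (rule summable_on_SigmaI[OF inner]) (use assms in \<open>auto simp: add.commute\<close>)
  then have sm: "?F a t s x u summable_on ?S"
    by - (rule abs_summable_summable, simp add: case_prod_unfold abs_mult power_abs)
  have bij: "(?F a t s x u has_sum S) ?S \<longleftrightarrow> (?G has_sum S) (UNIV \<times> UNIV)" for S
    by (rule has_sum_reindex_bij_witness
        [where j = "\<lambda>((i, j), (k, l)). ((k, l), (i - k, j - l))" and
          i = "\<lambda>((k, l), (m, n)). ((k + m, l + n), (k, l))"]) (auto simp: mult_ac)
  show ?thesis1
    using bij sm by (meson has_sum_imp_summable has_sum_infsum)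
  assume "((\<lambda>(i, j). a (i, j) * (s + t) ^ i * (u + x) ^ j) has_sum S) UNIV"
  then have "(?F a t s x u has_sum S) ?S"
    using has_sum_SigmaI[OF inner _ sm] by blast
  then show ?thesis2 using bij by blast
qed

text \<open>The coefficients at the new centre are the inner sums over \<open>(m, n)\<close>, the
  exponents of the coordinates of the centre. The radius \<delta> is the room left by a dominating
  point of \<open>W\<close>.\<close>

lemma series2_reexpand:
  assumes W: "open W" and a: "convergent2 a W" and tx: "(t, x) \<in> W"
  obtains \<delta> d where "\<delta> > 0"
    "\<And>s u. \<bar>s\<bar> < \<delta> \<Longrightarrow> \<bar>u\<bar> < \<delta> \<Longrightarrow> ((\<lambda>(k, l). d (k, l) * s ^ k * u ^ l) has_sum series2 a (t + s) (x + u)) UNIV"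
proof -
  obtain \<delta> t' x' where d: "\<delta> > 0" "\<bar>t'\<bar> = \<bar>t\<bar> + \<delta>" "\<bar>x'\<bar> = \<bar>x\<bar> + \<delta>" "(t', x') \<in> W"
    using open_enlarge[OF W tx] by metis
  note conv = convergent2D(1)[OF a d(4), unfolded d]
  have conv': "(\<lambda>(i, j). \<bar>a (i, j)\<bar> * (\<bar>t\<bar> + \<bar>s\<bar>) ^ i * (\<bar>x\<bar> + \<bar>u\<bar>) ^ j) summable_on UNIV"
    if "\<bar>s\<bar> \<le> \<delta>" "\<bar>u\<bar> \<le> \<delta>" for s u
    by (rule summable_on_comparison_test[OF conv]) (use that in \<open>auto intro!: mult_mono power_mono\<close>)
  let ?h = "\<lambda>k l (m, n). a (k + m, l + n) * real ((k + m) choose k) * real ((l + n) choose l) * t ^ m * x ^ n"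
  define d where "d = (\<lambda>(k, l). infsum (?h k l) UNIV)"
  have hd: "(?h k l has_sum d (k, l)) UNIV" for k l
    unfolding d_def prod.case
  proof (rule has_sum_infsum)
    \<comment> \<open>Summability of the whole family at s = u = \<delta> gives that of each fibre,
      from which the nonzero factor \<open>\<delta> ^ k * \<delta> ^ l\<close> is divided
      out.\<close>
    have "(\<lambda>(kl, mn). (\<lambda>((k, l), (m, n)). a (k + m, l + n) * real ((k + m) choose k) * real ((l + n) choose l)
      * t ^ m * \<delta> ^ k * x ^ n * \<delta> ^ l) (kl, mn)) summable_on Sigma UNIV (\<lambda>_. UNIV)"
      using convergent2_abs_shift(1)[OF conv'[of \<delta> \<delta>]] d(1) by (simp add: case_prod_unfold)
    from summable_on_SigmaD1[OF this, of "(k, l)"]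
    have "(\<lambda>(m, n). a (k + m, l + n) * real ((k + m) choose k) * real ((l + n) choose l)
      * t ^ m * \<delta> ^ k * x ^ n * \<delta> ^ l) summable_on UNIV" by simp
    then have "(\<lambda>z. (case z of (m, n) \<Rightarrow> a (k + m, l + n) * real ((k + m) choose k) * real ((l + n) choose l)
      * t ^ m * \<delta> ^ k * x ^ n * \<delta> ^ l) * (1 / (\<delta> ^ k * \<delta> ^ l))) summable_on UNIV"
      by (rule summable_on_cmult_left)
    then show "?h k l summable_on UNIV"
      using d(1) by (simp add: case_prod_unfold mult_ac)
  qed
  show thesis
  proof (rule that[OF d(1)])
    fix s u :: real assume su: "\<bar>s\<bar> < \<delta>" "\<bar>u\<bar> < \<delta>"
    have "convergent2 a {(t + s, x + u)}"
      unfolding convergent2_def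
    proof clarify
      show "(\<lambda>(i, j). \<bar>a (i, j)\<bar> * \<bar>t + s\<bar> ^ i * \<bar>x + u\<bar> ^ j) summable_on UNIV"
        by (rule summable_on_comparison_test[OF conv]) (use su in \<open>auto intro!: mult_mono power_mono\<close>)
    qed
    then have "((\<lambda>(i, j). a (i, j) * (s + t) ^ i * (u + x) ^ j) has_sum series2 a (t + s) (x + u)) UNIV"
      using convergent2D(2)[of a "{(t + s, x + u)}" "t + s" "x + u"] by (simp add: add.commute)
    from convergent2_abs_shift(2)[OF conv' this] su
    have "((\<lambda>((k, l), (m, n)). a (k + m, l + n) * real ((k + m) choose k) * real ((l + n) choose l)
      * t ^ m * s ^ k * x ^ n * u ^ l) has_sum series2 a (t + s) (x + u)) (UNIV \<times> UNIV)" by simp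
    then show "((\<lambda>(k, l). d (k, l) * s ^ k * u ^ l) has_sum series2 a (t + s) (x + u)) UNIV"
    proof (rule has_sum_SigmaD, goal_cases)
      case (1 kl)
      obtain k l where kl: "kl = (k, l)" by force
      show ?case
        using has_sum_cmult_left[OF hd[of k l], of "s ^ k * u ^ l"]
        by (simp add: kl case_prod_unfold mult_ac)
    qed
  qed
qed

text \<open>The series re-expanded at \<open>p\<close> is already the required one; what remains is
  to pass from pairs of exponents to multi-indices on the basis vectors (1, 0) and (0, 1).\<close>

lemma real_analytic_at_series2:
  assumes W: "open W" and a: "convergent2 a W" and p: "p \<in> W"
  shows "real_analytic_at (\<lambda>(t, x). series2 a t x) p"
proof -
  obtain t x where tx: "p = (t, x)" by force
  have "(t, x) \<in> W" using p tx by simp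
  then show ?thesis
  proof (rule series2_reexpand[OF W a])
    fix \<delta> d assume \<delta>: "\<delta> > (0::real)"
      and d: "\<And>s u. \<bar>s\<bar> < \<delta> \<Longrightarrow> \<bar>u\<bar> < \<delta> \<Longrightarrow> ((\<lambda>(k, l). d (k, l) * s ^ k * u ^ l) has_sum series2 a (t + s) (x + u)) UNIV"
    let ?B = "Basis :: (real \<times> real) set"
    have B: "?B = {(1, 0), (0, 1)}" by (auto simp: Basis_prod_def)
    have "((\<lambda>\<alpha>. (\<Prod>b\<in>?B. ((q - p) \<bullet> b) ^ \<alpha> b) *\<^sub>R d (\<alpha> (1, 0), \<alpha> (0, 1))) has_sum (case q of (t, x) \<Rightarrow> series2 a t x)) (?B \<rightarrow>\<^sub>E UNIV)"
      if q: "q \<in> ball p \<delta>" for q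
    proof -
      obtain t' x' where q': "q = (t', x')" by force
      have "\<bar>t' - t\<bar> < \<delta>" "\<bar>x' - x\<bar> < \<delta>"
        using q dist_fst_le[of p q] dist_snd_le[of p q] by (auto simp: tx q' dist_real_def)
      from d[OF this] have *: "((\<lambda>(k, l). d (k, l) * (t' - t) ^ k * (x' - x) ^ l) has_sum series2 a t' x') UNIV" by simp
      let ?C = "{(1 :: real, 0 :: real), (0, 1)}"
      let ?i = "\<lambda>(k, l). \<lambda>b\<in>?C. if b = (1, 0) then k else (l :: nat)"
      have "((\<lambda>\<alpha>. (\<Prod>b\<in>?C. ((q - p) \<bullet> b) ^ \<alpha> b) *\<^sub>R d (\<alpha> (1, 0), \<alpha> (0, 1))) has_sum series2 a t' x') (?C \<rightarrow>\<^sub>E UNIV)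
          \<longleftrightarrow> ((\<lambda>(k, l). d (k, l) * (t' - t) ^ k * (x' - x) ^ l) has_sum series2 a t' x') UNIV"
      proof (rule has_sum_reindex_bij_witness[where j = "\<lambda>\<alpha>. (\<alpha> (1, 0), \<alpha> (0, 1))" and i = ?i])
        fix \<alpha> assume \<alpha>: "\<alpha> \<in> ?C \<rightarrow>\<^sub>E (UNIV :: nat set)"
        show "?i (\<alpha> (1, 0), \<alpha> (0, 1)) = \<alpha>"
        proof (rule PiE_ext[OF _ \<alpha>])
          show "?i (\<alpha> (1, 0), \<alpha> (0, 1)) \<in> ?C \<rightarrow>\<^sub>E UNIV" by simp
          show "?i (\<alpha> (1, 0), \<alpha> (0, 1)) b = \<alpha> b" if "b \<in> ?C" for b
            using that by (cases "b = (1, 0)") simp_all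
        qed
        show "(case (\<alpha> (1, 0), \<alpha> (0, 1)) of (k, l) \<Rightarrow> d (k, l) * (t' - t) ^ k * (x' - x) ^ l) =
            (\<Prod>b\<in>?C. ((q - p) \<bullet> b) ^ \<alpha> b) *\<^sub>R d (\<alpha> (1, 0), \<alpha> (0, 1))"
          by (simp add: tx q')
      qed (simp_all split: prod.splits)
      from iffD2[OF this *] show ?thesis
        by (simp only: B q' prod.case)
    qed
    with \<delta> show ?thesis
      unfolding real_analytic_at_def
      by (intro exI[of _ \<delta>] exI[of _ "\<lambda>\<alpha>. d (\<alpha> (1, 0), \<alpha> (0, 1))"] conjI ballI)
  qed
qed

lemma has_sum_vec:
  assumes "\<And>k. ((\<lambda>x. f x $ k) has_sum s $ k) A"
  shows "(f has_sum (s :: real ^ 'n)) A"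
  using assms unfolding has_sum_def
  by (intro vec_tendstoI) (simp add: sum_component)

lemma real_analytic_at_vec:
  fixes f :: "'a::euclidean_space \<Rightarrow> real ^ 'n"
  shows "real_analytic_at f a \<longleftrightarrow> (\<forall>k. real_analytic_at (\<lambda>x. f x $ k) a)"
proof
  assume "real_analytic_at f a"
  then obtain r c where r: "r > 0"
    and c: "\<And>x. x \<in> ball a r \<Longrightarrow> ((\<lambda>\<alpha>. (\<Prod>b\<in>Basis. ((x - a) \<bullet> b) ^ \<alpha> b) *\<^sub>R c \<alpha>) has_sum f x) (Basis \<rightarrow>\<^sub>E UNIV)"
    unfolding real_analytic_at_def by blast
  show "\<forall>k. real_analytic_at (\<lambda>x. f x $ k) a"
    unfolding real_analytic_at_def
  proof (intro allI exI[of _ r] conjI r)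
    fix k
    have "((\<lambda>\<alpha>. (\<Prod>b\<in>Basis. ((x - a) \<bullet> b) ^ \<alpha> b) *\<^sub>R (c \<alpha> $ k)) has_sum f x $ k) (Basis \<rightarrow>\<^sub>E UNIV)"
      if "x \<in> ball a r" for x
      using has_sum_bounded_linear[OF bounded_linear_vec_nth[of k] c[OF that]]
      by (simp only: vector_scaleR_component)
    then show "\<exists>c. \<forall>x\<in>ball a r. ((\<lambda>\<alpha>. (\<Prod>b\<in>Basis. ((x - a) \<bullet> b) ^ \<alpha> b) *\<^sub>R c \<alpha>) has_sum f x $ k) (Basis \<rightarrow>\<^sub>E UNIV)"
      by (intro exI[of _ "\<lambda>\<alpha>. c \<alpha> $ k"] ballI)
  qed
next
  assume "\<forall>k. real_analytic_at (\<lambda>x. f x $ k) a"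
  moreover define P where "P k r c \<longleftrightarrow> (\<forall>x\<in>ball a r. ((\<lambda>\<alpha>. (\<Prod>b\<in>Basis. ((x - a) \<bullet> b) ^ \<alpha> b) *\<^sub>R c \<alpha>) has_sum f x $ k)
      (Basis \<rightarrow>\<^sub>E UNIV))" for k r c
  ultimately have "\<forall>k. \<exists>r>0. \<exists>c. P k r c"
    unfolding real_analytic_at_def by blast
  then obtain r c where r: "\<And>k. r k > 0" and c: "\<And>k. P k (r k) (c k)"
    by metis
  show "real_analytic_at f a"
    unfolding real_analytic_at_def
  proof (intro exI[of _ "Min (range r)"] exI[of _ "\<lambda>\<alpha>. \<chi> k. c k \<alpha>"] conjI ballI)
    show "Min (range r) > 0" using r by simp
    fix x assume x: "x \<in> ball a (Min (range r))"
    show "((\<lambda>\<alpha>. (\<Prod>b\<in>Basis. ((x - a) \<bullet> b) ^ \<alpha> b) *\<^sub>R (\<chi> k. c k \<alpha>)) has_sum f x) (Basis \<rightarrow>\<^sub>E UNIV)"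
      by (rule has_sum_vec) (use c x in \<open>auto simp: P_def\<close>)
  qed
qed

lemma real_analytic_at_real:
  fixes f :: "real \<Rightarrow> real"
  shows "real_analytic_at f a \<longleftrightarrow>
    (\<exists>r>0. \<exists>c. \<forall>s. \<bar>s\<bar> < r \<longrightarrow> ((\<lambda>n. c n * s ^ n) has_sum f (a + s)) UNIV)"
proof -
  have conv: "((\<lambda>\<alpha>. (\<Prod>b\<in>Basis. ((x - a) \<bullet> b) ^ \<alpha> b) *\<^sub>R c' \<alpha>) has_sum S) (Basis \<rightarrow>\<^sub>E UNIV) \<longleftrightarrow>
      ((\<lambda>n. c n * (x - a) ^ n) has_sum S) UNIV"
    if "\<And>n. c' (\<lambda>b\<in>{1}. n) = c n" for x S c' and c :: "nat \<Rightarrow> real"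
  proof (rule has_sum_reindex_bij_witness[where j = "\<lambda>\<alpha>. \<alpha> (1::real)" and i = "\<lambda>n. \<lambda>b\<in>{1::real}. n"])
    fix \<alpha> :: "real \<Rightarrow> nat" assume "\<alpha> \<in> Basis \<rightarrow>\<^sub>E UNIV"
    then show *: "(\<lambda>b\<in>{1}. \<alpha> 1) = \<alpha>"
      by (auto simp: PiE_iff extensional_def fun_eq_iff)
    show "c (\<alpha> 1) * (x - a) ^ \<alpha> 1 = (\<Prod>b\<in>Basis. ((x - a) \<bullet> b) ^ \<alpha> b) *\<^sub>R c' \<alpha>"
      using that[of "\<alpha> 1"] unfolding * by simp
  qed auto
  show ?thesis
  proof
    assume "real_analytic_at f a"
    then obtain r c where r: "r > 0" and c: "\<And>x. x \<in> ball a r \<Longrightarrow>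
        ((\<lambda>\<alpha>. (\<Prod>b\<in>Basis. ((x - a) \<bullet> b) ^ \<alpha> b) *\<^sub>R c \<alpha>) has_sum f x) (Basis \<rightarrow>\<^sub>E UNIV)"
      unfolding real_analytic_at_def by blast
    have "((\<lambda>n. c (\<lambda>b\<in>{1}. n) * s ^ n) has_sum f (a + s)) UNIV" if "\<bar>s\<bar> < r" for s
      using c[of "a + s"] conv[of c "\<lambda>n. c (\<lambda>b\<in>{1}. n)" "a + s" "f (a + s)", OF refl] that
      by (simp add: dist_real_def)
    with r show "\<exists>r>0. \<exists>c. \<forall>s. \<bar>s\<bar> < r \<longrightarrow> ((\<lambda>n. c n * s ^ n) has_sum f (a + s)) UNIV"
      by (intro exI[of _ r] conjI exI[of _ "\<lambda>n. c (\<lambda>b\<in>{1}. n)"]) auto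
  next
    assume "\<exists>r>0. \<exists>c. \<forall>s. \<bar>s\<bar> < r \<longrightarrow> ((\<lambda>n. c n * s ^ n) has_sum f (a + s)) UNIV"
    then obtain r c where r: "r > 0" and c: "\<And>s. \<bar>s\<bar> < r \<Longrightarrow> ((\<lambda>n. c n * s ^ n) has_sum f (a + s)) UNIV"
      by blast
    show "real_analytic_at f a"
      unfolding real_analytic_at_def
    proof (intro exI[of _ r] conjI r exI[of _ "\<lambda>\<alpha>. c (\<alpha> 1)"] ballI)
      fix x assume "x \<in> ball a r"
      then show "((\<lambda>\<alpha>. (\<Prod>b\<in>Basis. ((x - a) \<bullet> b) ^ \<alpha> b) *\<^sub>R c (\<alpha> 1)) has_sum f x) (Basis \<rightarrow>\<^sub>E UNIV)"
        using c[of "x - a"] by (subst conv[of _ c]) (auto simp: dist_real_def abs_minus_commute)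
    qed
  qed
qed

section \<open>Power series in a Banach algebra and uniform Lipschitz bounds\<close>

text \<open>Functional calculus for power series in several variables. The variables are indexed by
  basis vectors to match the multi-indices in the definition of real analyticity.\<close>

definition power_subst ::
    "(('e::euclidean_space \<Rightarrow> nat) \<Rightarrow> real) \<Rightarrow> ('e \<Rightarrow> 'a::{real_normed_algebra_1, comm_ring_1, banach}) \<Rightarrow> 'a"
  where "power_subst c X = (\<Sum>\<^sub>\<infinity>\<alpha>\<in>Basis \<rightarrow>\<^sub>E UNIV. c \<alpha> *\<^sub>R (\<Prod>b\<in>Basis. X b ^ \<alpha> b))"

definition abs_conv_radius_ge :: "(('e::euclidean_space \<Rightarrow> nat) \<Rightarrow> real) \<Rightarrow> real \<Rightarrow> bool"
  where "abs_conv_radius_ge c s \<longleftrightarrow>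
    (\<lambda>\<alpha>. \<bar>c \<alpha>\<bar> * s ^ (\<Sum>b\<in>Basis. \<alpha> b)) summable_on (Basis \<rightarrow>\<^sub>E UNIV)"

lemma abs_conv_radius_ge_mono:
  "abs_conv_radius_ge c s \<Longrightarrow> 0 \<le> r \<Longrightarrow> r \<le> s \<Longrightarrow> abs_conv_radius_ge c r"
  unfolding abs_conv_radius_ge_def
  by (erule summable_on_comparison_test) (auto intro!: mult_left_mono power_mono)

text \<open>The ball is traded for a cube because the variables will be estimated one at a time.
  Absolute convergence on the whole cube comes from the corner with all coordinates equal to
  \<open>s\<close>.\<close>

lemma real_analytic_at_0_radius:
  fixes f :: "'e::euclidean_space \<Rightarrow> real"
  assumes "real_analytic_at f 0"
  obtains s c where "s > 0" "abs_conv_radius_ge c s"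
    "\<And>x. (\<And>b. b \<in> Basis \<Longrightarrow> \<bar>x \<bullet> b\<bar> \<le> s) \<Longrightarrow>
      ((\<lambda>\<alpha>. c \<alpha> * (\<Prod>b\<in>Basis. (x \<bullet> b) ^ \<alpha> b)) has_sum f x) (Basis \<rightarrow>\<^sub>E UNIV)"
proof -
  obtain r c where r: "r > 0" and c: "\<And>x. x \<in> ball 0 r \<Longrightarrow>
      ((\<lambda>\<alpha>. (\<Prod>b\<in>Basis. ((x - 0) \<bullet> b) ^ \<alpha> b) *\<^sub>R c \<alpha>) has_sum f x) (Basis \<rightarrow>\<^sub>E UNIV)"
    using assms unfolding real_analytic_at_def by blast
  \<comment> \<open>A point of the cube has norm at most \<open>DIM('e)\<close> times
    \<open>s\<close>, that is r / 2, so the cube lies in the ball.\<close>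
  define s where "s = r / (2 * real DIM('e))"
  have s: "s > 0" "real DIM('e) * s < r" using r by (auto simp: s_def)
  have sum: "((\<lambda>\<alpha>. c \<alpha> * (\<Prod>b\<in>Basis. (x \<bullet> b) ^ \<alpha> b)) has_sum f x) (Basis \<rightarrow>\<^sub>E UNIV)"
    if "\<And>b. b \<in> Basis \<Longrightarrow> \<bar>x \<bullet> b\<bar> \<le> s" for x
  proof -
    have "norm x \<le> (\<Sum>b\<in>Basis. \<bar>x \<bullet> b\<bar>)" by (rule norm_le_l1)
    also have "\<dots> \<le> real DIM('e) * s" by (rule sum_bounded_above) (rule that)
    finally show ?thesis using c[of x] s by (simp add: mult.commute)
  qed
  define x1 where "x1 = (\<Sum>b\<in>Basis. s *\<^sub>R b :: 'e)"
  have x1: "x1 \<bullet> b = s" if "b \<in> Basis" for b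
    using that by (simp add: x1_def inner_sum_left inner_Basis if_distrib if_distribR cong: if_cong)
  have "(\<lambda>\<alpha>. c \<alpha> * (\<Prod>b\<in>Basis. (x1 \<bullet> b) ^ \<alpha> b)) summable_on (Basis \<rightarrow>\<^sub>E UNIV)"
    by (rule has_sum_imp_summable[OF sum]) (use s x1 in auto)
  then have "(\<lambda>\<alpha>. c \<alpha> * s ^ (\<Sum>b\<in>Basis. \<alpha> b)) summable_on (Basis \<rightarrow>\<^sub>E UNIV)"
    by (simp add: x1 power_sum cong: prod.cong)
  from this[THEN iffD1[OF summable_on_iff_abs_summable_on_real]]
  have "abs_conv_radius_ge c s"
    using s by (simp add: abs_conv_radius_ge_def abs_mult)
  then show thesis using that s(1) sum by blast
qed

lemma norm_monomial_le:
  fixes X :: "'e::euclidean_space \<Rightarrow> 'a::{real_normed_algebra_1, comm_ring_1, banach}"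
  assumes "\<And>b. b \<in> Basis \<Longrightarrow> norm (X b) \<le> s"
  shows "norm (\<Prod>b\<in>Basis. X b ^ \<alpha> b) \<le> s ^ (\<Sum>b\<in>Basis. \<alpha> b)"
proof -
  have "norm (\<Prod>b\<in>Basis. X b ^ \<alpha> b) \<le> (\<Prod>b\<in>Basis. norm (X b ^ \<alpha> b))"
    by (rule norm_prod_le)
  also have "\<dots> \<le> (\<Prod>b\<in>Basis. s ^ \<alpha> b)"
    using assms by (intro prod_mono) (auto intro!: order_trans[OF norm_power_ineq] power_mono)
  finally show ?thesis by (simp add: power_sum)
qed

lemma power_subst_has_sum:
  fixes X :: "'e::euclidean_space \<Rightarrow> 'a::{real_normed_algebra_1, comm_ring_1, banach}"
  assumes c: "abs_conv_radius_ge c s" and X: "\<And>b. b \<in> Basis \<Longrightarrow> norm (X b) \<le> s"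
  shows "((\<lambda>\<alpha>. c \<alpha> *\<^sub>R (\<Prod>b\<in>Basis. X b ^ \<alpha> b)) has_sum power_subst c X) (Basis \<rightarrow>\<^sub>E UNIV)"
    and "norm (power_subst c X) \<le> (\<Sum>\<^sub>\<infinity>\<alpha>\<in>Basis \<rightarrow>\<^sub>E UNIV. \<bar>c \<alpha>\<bar> * s ^ (\<Sum>b\<in>Basis. \<alpha> b))"
proof -
  have le: "norm (c \<alpha> *\<^sub>R (\<Prod>b\<in>Basis. X b ^ \<alpha> b)) \<le> \<bar>c \<alpha>\<bar> * s ^ (\<Sum>b\<in>Basis. \<alpha> b)" for \<alpha>
    using norm_monomial_le[OF X, where \<alpha>=\<alpha>] by (simp add: mult_left_mono)
  have "(\<lambda>\<alpha>. c \<alpha> *\<^sub>R (\<Prod>b\<in>Basis. X b ^ \<alpha> b)) summable_on (Basis \<rightarrow>\<^sub>E UNIV)"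
    using c le unfolding abs_conv_radius_ge_def
    by - (rule abs_summable_summable, rule summable_on_comparison_test, auto)
  then show *: "((\<lambda>\<alpha>. c \<alpha> *\<^sub>R (\<Prod>b\<in>Basis. X b ^ \<alpha> b)) has_sum power_subst c X) (Basis \<rightarrow>\<^sub>E UNIV)"
    unfolding power_subst_def by (rule has_sum_infsum)
  show "norm (power_subst c X) \<le> (\<Sum>\<^sub>\<infinity>\<alpha>\<in>Basis \<rightarrow>\<^sub>E UNIV. \<bar>c \<alpha>\<bar> * s ^ (\<Sum>b\<in>Basis. \<alpha> b))"
    by (rule norm_infsum_le[OF * has_sum_infsum[OF c[unfolded abs_conv_radius_ge_def]] le])
qed

text \<open>Divided by \<open>s\<close>, all variables have norm at most 1, and telescoping gives a
  Lipschitz constant equal to the total degree n. The estimate n \<le> 2^n then accounts for the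
  radius \<open>2 * s\<close>.\<close>

lemma norm_monomial_diff_le:
  fixes X Y :: "'e::euclidean_space \<Rightarrow> 'a::{real_normed_algebra_1, comm_ring_1, banach}"
  assumes s: "s > 0" and X: "\<And>b. b \<in> Basis \<Longrightarrow> norm (X b) \<le> s" and Y: "\<And>b. b \<in> Basis \<Longrightarrow> norm (Y b) \<le> s"
  shows "norm ((\<Prod>b\<in>Basis. X b ^ \<alpha> b) - (\<Prod>b\<in>Basis. Y b ^ \<alpha> b)) \<le>
    (2 * s) ^ (\<Sum>b\<in>Basis. \<alpha> b) * ((\<Sum>b\<in>Basis. norm (X b - Y b)) / s)"
proof -
  let ?n = "\<Sum>b\<in>Basis. \<alpha> b" and ?d = "\<Sum>b\<in>Basis. norm (X b - Y b)"
  define X' Y' where "X' b = X b /\<^sub>R s" and "Y' b = Y b /\<^sub>R s" for b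
  have X': "norm (X' b) \<le> 1" and Y': "norm (Y' b) \<le> 1" if "b \<in> Basis" for b
    using X[OF that] Y[OF that] s by (auto simp: X'_def Y'_def field_simps)
  have scale: "(\<Prod>b\<in>Basis. Z b ^ \<alpha> b) = s ^ ?n *\<^sub>R (\<Prod>b\<in>Basis. (Z b /\<^sub>R s) ^ \<alpha> b)" for Z :: "'e \<Rightarrow> 'a"
  proof -
    have "(\<Prod>b\<in>Basis. Z b ^ \<alpha> b) = (\<Prod>b\<in>Basis. s ^ \<alpha> b *\<^sub>R (Z b /\<^sub>R s) ^ \<alpha> b)"
      using s by (intro prod.cong refl) (simp flip: scaleR_power)
    also have "\<dots> = (\<Prod>b\<in>Basis. s ^ \<alpha> b) *\<^sub>R (\<Prod>b\<in>Basis. (Z b /\<^sub>R s) ^ \<alpha> b)"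
      by (induction rule: finite_induct[OF finite_Basis]) (auto simp: mult_ac)
    finally show ?thesis by (simp add: power_sum)
  qed
  have "norm ((\<Prod>b\<in>Basis. X' b ^ \<alpha> b) - (\<Prod>b\<in>Basis. Y' b ^ \<alpha> b)) \<le> (\<Sum>b\<in>Basis. norm (X' b ^ \<alpha> b - Y' b ^ \<alpha> b))"
    using X' Y' by (intro norm_prod_diff order_trans[OF norm_power_ineq] power_le_one) auto
  also have "\<dots> \<le> (\<Sum>b\<in>Basis. real ?n * norm (X' b - Y' b))"
  proof (rule sum_mono)
    fix b :: 'e assume b: "b \<in> Basis"
    have "norm (X' b ^ \<alpha> b - Y' b ^ \<alpha> b) \<le> real (\<alpha> b) * norm (X' b - Y' b)"
      by (rule norm_power_diff[OF X'[OF b] Y'[OF b]])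
    also have "\<dots> \<le> real ?n * norm (X' b - Y' b)"
      using b by (intro mult_right_mono) (auto intro: member_le_sum simp del: of_nat_sum)
    finally show "norm (X' b ^ \<alpha> b - Y' b ^ \<alpha> b) \<le> real ?n * norm (X' b - Y' b)" .
  qed
  also have "\<dots> = real ?n * (?d / s)"
    using s by (simp add: X'_def Y'_def flip: scaleR_diff_right sum_distrib_left)
      (simp add: divide_inverse mult_ac sum_distrib_left sum_distrib_right)
  also have "\<dots> \<le> 2 ^ ?n * (?d / s)"
    using s of_nat_less_two_power[of ?n, where 'a=real] by (intro mult_right_mono) (auto intro!: divide_nonneg_pos sum_nonneg simp del: of_nat_sum)
  finally have "s ^ ?n * norm ((\<Prod>b\<in>Basis. X' b ^ \<alpha> b) - (\<Prod>b\<in>Basis. Y' b ^ \<alpha> b)) \<le> s ^ ?n * (2 ^ ?n * (?d / s))"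
    using s by (intro mult_left_mono) auto
  then show ?thesis
    using s unfolding scale[of X] scale[of Y] X'_def Y'_def
    by (simp add: power_mult_distrib mult_ac flip: scaleR_diff_right)
qed

lemma power_subst_lipschitz:
  fixes X Y :: "'e::euclidean_space \<Rightarrow> 'a::{real_normed_algebra_1, comm_ring_1, banach}"
  assumes c: "abs_conv_radius_ge c (2 * s)" and s: "s > 0"
    and X: "\<And>b. b \<in> Basis \<Longrightarrow> norm (X b) \<le> s" and Y: "\<And>b. b \<in> Basis \<Longrightarrow> norm (Y b) \<le> s"
  shows "norm (power_subst c X - power_subst c Y) \<le>
    (\<Sum>\<^sub>\<infinity>\<alpha>\<in>Basis \<rightarrow>\<^sub>E UNIV. \<bar>c \<alpha>\<bar> * (2 * s) ^ (\<Sum>b\<in>Basis. \<alpha> b)) * ((\<Sum>b\<in>Basis. norm (X b - Y b)) / s)"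
proof (rule norm_infsum_le)
  have c': "abs_conv_radius_ge c s"
    using abs_conv_radius_ge_mono[OF c, of s] s by simp
  show "((\<lambda>\<alpha>. c \<alpha> *\<^sub>R (\<Prod>b\<in>Basis. X b ^ \<alpha> b) + - (c \<alpha> *\<^sub>R (\<Prod>b\<in>Basis. Y b ^ \<alpha> b))) has_sum
      power_subst c X - power_subst c Y) (Basis \<rightarrow>\<^sub>E UNIV)"
    unfolding diff_conv_add_uminus
    by (intro has_sum_add has_sum_uminusI power_subst_has_sum(1)[OF c'] X Y)
  show "((\<lambda>\<alpha>. \<bar>c \<alpha>\<bar> * (2 * s) ^ (\<Sum>b\<in>Basis. \<alpha> b) * ((\<Sum>b\<in>Basis. norm (X b - Y b)) / s)) has_sum
    (\<Sum>\<^sub>\<infinity>\<alpha>\<in>Basis \<rightarrow>\<^sub>E UNIV. \<bar>c \<alpha>\<bar> * (2 * s) ^ (\<Sum>b\<in>Basis. \<alpha> b)) * ((\<Sum>b\<in>Basis. norm (X b - Y b)) / s))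
      (Basis \<rightarrow>\<^sub>E UNIV)"
    by (intro has_sum_cmult_left has_sum_infsum) (use c in \<open>simp add: abs_conv_radius_ge_def\<close>)
  show "norm (c \<alpha> *\<^sub>R (\<Prod>b\<in>Basis. X b ^ \<alpha> b) + - (c \<alpha> *\<^sub>R (\<Prod>b\<in>Basis. Y b ^ \<alpha> b))) \<le>
      \<bar>c \<alpha>\<bar> * (2 * s) ^ (\<Sum>b\<in>Basis. \<alpha> b) * ((\<Sum>b\<in>Basis. norm (X b - Y b)) / s)" for \<alpha>
    using mult_left_mono[OF norm_monomial_diff_le[OF s X Y, where \<alpha>=\<alpha>] abs_ge_zero[of "c \<alpha>"]]
    by (simp add: mult.assoc flip: scaleR_diff_right)
qed

text \<open>Evaluation is continuous, linear and multiplicative, hence passes through the infinite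
  sum and into each monomial. The evaluated variables stay in the cube because evaluation does not
  exceed the norm.\<close>

lemma ev2_power_subst:
  fixes f :: "'e::euclidean_space \<Rightarrow> real"
  assumes p: "p \<in> diamond 1 1" and c: "abs_conv_radius_ge c s"
    and f: "\<And>x. (\<And>b. b \<in> Basis \<Longrightarrow> \<bar>x \<bullet> b\<bar> \<le> s) \<Longrightarrow>
      ((\<lambda>\<alpha>. c \<alpha> * (\<Prod>b\<in>Basis. (x \<bullet> b) ^ \<alpha> b)) has_sum f x) (Basis \<rightarrow>\<^sub>E UNIV)"
    and X: "\<And>b. b \<in> Basis \<Longrightarrow> norm (X b) \<le> s"
    and x: "\<And>b. b \<in> Basis \<Longrightarrow> ev2 p (X b) = x \<bullet> b"
  shows "ev2 p (power_subst c X) = f x"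
proof -
  have "((\<lambda>\<alpha>. ev2 p (c \<alpha> *\<^sub>R (\<Prod>b\<in>Basis. X b ^ \<alpha> b))) has_sum ev2 p (power_subst c X)) (Basis \<rightarrow>\<^sub>E UNIV)"
    by (rule has_sum_bounded_linear[OF bounded_linear_ev2[OF p] power_subst_has_sum(1)[OF c X]])
  then have "((\<lambda>\<alpha>. c \<alpha> * (\<Prod>b\<in>Basis. (x \<bullet> b) ^ \<alpha> b)) has_sum ev2 p (power_subst c X)) (Basis \<rightarrow>\<^sub>E UNIV)"
    using p x by (simp add: ev2_prod cong: prod.cong)
  moreover have "\<bar>x \<bullet> b\<bar> \<le> s" if "b \<in> Basis" for b
    using abs_ev2_le[OF p, of "X b"] X[OF that] x[OF that] by simp
  ultimately show ?thesis
    using f has_sum_unique by blast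
qed

text \<open>
  The parameter \<open>p\<close> will be the time scale \<open>\<tau>\<close>: the constants must not depend on it.
\<close>

definition unif_bounded_lipschitz ::
    "'p set \<Rightarrow> 'z::real_normed_vector set \<Rightarrow> ('p \<Rightarrow> 'z \<Rightarrow> 'a::real_normed_vector) \<Rightarrow> bool"
  where "unif_bounded_lipschitz P K F \<longleftrightarrow>
    (\<exists>M. \<forall>p\<in>P. \<forall>z\<in>K. norm (F p z) \<le> M) \<and>
    (\<exists>L. \<forall>p\<in>P. \<forall>z\<in>K. \<forall>w\<in>K. norm (F p z - F p w) \<le> L * norm (z - w))"

lemma unif_bounded_lipschitzE:
  assumes "unif_bounded_lipschitz P K F"
  obtains M L where "M \<ge> 0" "L \<ge> 0" "\<And>p z. p \<in> P \<Longrightarrow> z \<in> K \<Longrightarrow> norm (F p z) \<le> M"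
    "\<And>p z w. p \<in> P \<Longrightarrow> z \<in> K \<Longrightarrow> w \<in> K \<Longrightarrow> norm (F p z - F p w) \<le> L * norm (z - w)"
proof -
  obtain M L where M: "\<And>p z. p \<in> P \<Longrightarrow> z \<in> K \<Longrightarrow> norm (F p z) \<le> M"
    and L: "\<And>p z w. p \<in> P \<Longrightarrow> z \<in> K \<Longrightarrow> w \<in> K \<Longrightarrow> norm (F p z - F p w) \<le> L * norm (z - w)"
    using assms unfolding unif_bounded_lipschitz_def by blast
  have "M \<le> \<bar>M\<bar>" "L * norm (z - w) \<le> \<bar>L\<bar> * norm (z - w)" for z w :: 'b
    by (auto intro: mult_right_mono)
  then show thesis
    using order_trans[OF M] order_trans[OF L] by (intro that[of "\<bar>M\<bar>" "\<bar>L\<bar>"]) auto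
qed

lemma unif_bounded_lipschitzI:
  assumes "\<And>p z. p \<in> P \<Longrightarrow> z \<in> K \<Longrightarrow> norm (F p z) \<le> M"
    "\<And>p z w. p \<in> P \<Longrightarrow> z \<in> K \<Longrightarrow> w \<in> K \<Longrightarrow> norm (F p z - F p w) \<le> L * norm (z - w)"
  shows "unif_bounded_lipschitz P K F"
  using assms unfolding unif_bounded_lipschitz_def by blast

named_theorems ubl_intros

lemma unif_bounded_lipschitz_param:
  "(\<And>p. p \<in> P \<Longrightarrow> norm (g p) \<le> M) \<Longrightarrow> unif_bounded_lipschitz P K (\<lambda>p z. g p)"
  by (rule unif_bounded_lipschitzI[where M=M and L=0]) auto

lemma unif_bounded_lipschitz_const [ubl_intros]: "unif_bounded_lipschitz P K (\<lambda>p z. c)"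
  by (rule unif_bounded_lipschitz_param[where M="norm c"]) auto

lemma unif_bounded_lipschitz_ident:
  assumes "bounded K"
  shows "unif_bounded_lipschitz P K (\<lambda>p z. z)"
proof -
  obtain M where "\<And>z. z \<in> K \<Longrightarrow> norm z \<le> M"
    using assms bounded_iff by blast
  then show ?thesis
    by (intro unif_bounded_lipschitzI[where M=M and L=1]) auto
qed

lemma unif_bounded_lipschitz_bounded_linear:
  assumes "bounded_linear h" "unif_bounded_lipschitz P K F"
  shows "unif_bounded_lipschitz P K (\<lambda>p z. h (F p z))"
proof -
  interpret bounded_linear h by fact
  obtain B where B: "B \<ge> 0" "\<And>x. norm (h x) \<le> norm x * B" using nonneg_bounded by blast
  obtain M L where bnd: "M \<ge> 0" "L \<ge> 0" "\<And>p z. p \<in> P \<Longrightarrow> z \<in> K \<Longrightarrow> norm (F p z) \<le> M"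
    "\<And>p z w. p \<in> P \<Longrightarrow> z \<in> K \<Longrightarrow> w \<in> K \<Longrightarrow> norm (F p z - F p w) \<le> L * norm (z - w)"
    using unif_bounded_lipschitzE[OF assms(2)] by metis
  show ?thesis
  proof (rule unif_bounded_lipschitzI[where M="M * B" and L="L * B"])
    show "norm (h (F p z)) \<le> M * B" if "p \<in> P" "z \<in> K" for p z
      using B(2)[of "F p z"] mult_right_mono[OF bnd(3)[OF that] B(1)] by linarith
    show "norm (h (F p z) - h (F p w)) \<le> L * B * norm (z - w)" if "p \<in> P" "z \<in> K" "w \<in> K" for p z w
      using B(2)[of "F p z - F p w"] mult_right_mono[OF bnd(4)[OF that] B(1)] by (simp add: diff mult_ac)
  qed
qed

lemma unif_bounded_lipschitz_add [ubl_intros]: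
  assumes "unif_bounded_lipschitz P K F" "unif_bounded_lipschitz P K G"
  shows "unif_bounded_lipschitz P K (\<lambda>p z. F p z + G p z)"
proof -
  obtain M L where F: "\<And>p z. p \<in> P \<Longrightarrow> z \<in> K \<Longrightarrow> norm (F p z) \<le> M"
    "\<And>p z w. p \<in> P \<Longrightarrow> z \<in> K \<Longrightarrow> w \<in> K \<Longrightarrow> norm (F p z - F p w) \<le> L * norm (z - w)"
    using unif_bounded_lipschitzE[OF assms(1)] by metis
  obtain M' L' where G: "\<And>p z. p \<in> P \<Longrightarrow> z \<in> K \<Longrightarrow> norm (G p z) \<le> M'"
    "\<And>p z w. p \<in> P \<Longrightarrow> z \<in> K \<Longrightarrow> w \<in> K \<Longrightarrow> norm (G p z - G p w) \<le> L' * norm (z - w)"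
    using unif_bounded_lipschitzE[OF assms(2)] by metis
  show ?thesis
  proof (rule unif_bounded_lipschitzI[where M="M + M'" and L="L + L'"])
    show "norm (F p z + G p z) \<le> M + M'" if "p \<in> P" "z \<in> K" for p z
      by (rule norm_triangle_mono[OF F(1)[OF that] G(1)[OF that]])
    show "norm (F p z + G p z - (F p w + G p w)) \<le> (L + L') * norm (z - w)" if "p \<in> P" "z \<in> K" "w \<in> K" for p z w
      using norm_triangle_mono[OF F(2)[OF that] G(2)[OF that]] by (simp add: algebra_simps)
  qed
qed

lemma unif_bounded_lipschitz_diff [ubl_intros]:
  assumes "unif_bounded_lipschitz P K F" "unif_bounded_lipschitz P K G"
  shows "unif_bounded_lipschitz P K (\<lambda>p z. F p z - G p z)"
  using unif_bounded_lipschitz_add[OF assms(1) unif_bounded_lipschitz_bounded_linear[OF bounded_linear_minus[OF bounded_linear_ident] assms(2)]]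
  by simp

text \<open>The usual splitting of a difference of products. Bounds on both factors enter, which is
  why boundedness is carried along with the Lipschitz property.\<close>

lemma unif_bounded_lipschitz_bilinear:
  assumes "bounded_bilinear h" "unif_bounded_lipschitz P K F" "unif_bounded_lipschitz P K G"
  shows "unif_bounded_lipschitz P K (\<lambda>p z. h (F p z) (G p z))"
proof -
  interpret bounded_bilinear h by fact
  obtain B where B: "B \<ge> 0" "\<And>x y. norm (h x y) \<le> norm x * norm y * B" using nonneg_bounded by blast
  obtain M L where F: "M \<ge> 0" "L \<ge> 0" "\<And>p z. p \<in> P \<Longrightarrow> z \<in> K \<Longrightarrow> norm (F p z) \<le> M"
    "\<And>p z w. p \<in> P \<Longrightarrow> z \<in> K \<Longrightarrow> w \<in> K \<Longrightarrow> norm (F p z - F p w) \<le> L * norm (z - w)"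
    using unif_bounded_lipschitzE[OF assms(2)] by metis
  obtain M' L' where G: "M' \<ge> 0" "L' \<ge> 0" "\<And>p z. p \<in> P \<Longrightarrow> z \<in> K \<Longrightarrow> norm (G p z) \<le> M'"
    "\<And>p z w. p \<in> P \<Longrightarrow> z \<in> K \<Longrightarrow> w \<in> K \<Longrightarrow> norm (G p z - G p w) \<le> L' * norm (z - w)"
    using unif_bounded_lipschitzE[OF assms(3)] by metis
  have le: "norm (h x y) \<le> a * b * B" if "norm x \<le> a" "norm y \<le> b" for x y a b
  proof -
    have "norm x * norm y * B \<le> a * b * B"
      using that B(1) norm_ge_zero[of x] norm_ge_zero[of y] by (intro mult_right_mono mult_mono) linarith+
    then show ?thesis using B(2) order_trans by blast
  qed
  show ?thesis
  proof (rule unif_bounded_lipschitzI[where M="M * M' * B" and L="M * L' * B + L * M' * B"])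
    show "norm (h (F p z) (G p z)) \<le> M * M' * B" if "p \<in> P" "z \<in> K" for p z
      using F(3) G(3) that by (intro le) auto
    show "norm (h (F p z) (G p z) - h (F p w) (G p w)) \<le> (M * L' * B + L * M' * B) * norm (z - w)"
      if "p \<in> P" "z \<in> K" "w \<in> K" for p z w
    proof -
      have "h (F p z) (G p z) - h (F p w) (G p w) = h (F p z) (G p z - G p w) + h (F p z - F p w) (G p w)"
        by (simp add: diff_left diff_right)
      also have "norm \<dots> \<le> M * (L' * norm (z - w)) * B + L * norm (z - w) * M' * B"
        using F G that by (intro norm_triangle_mono le) auto
      finally show ?thesis by (simp add: algebra_simps)
    qed
  qed
qed

lemmas unif_bounded_lipschitz_mult [ubl_intros] =
  unif_bounded_lipschitz_bilinear[OF bounded_bilinear_mult]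

lemma unif_bounded_lipschitz_scaleR_const [ubl_intros]:
  "unif_bounded_lipschitz P K F \<Longrightarrow> unif_bounded_lipschitz P K (\<lambda>p z. r *\<^sub>R F p z)"
  by (rule unif_bounded_lipschitz_bounded_linear[OF bounded_linear_scaleR_right])

lemma unif_bounded_lipschitz_scaleR_param:
  "bounded P \<Longrightarrow> unif_bounded_lipschitz P K F \<Longrightarrow> unif_bounded_lipschitz P K (\<lambda>p z. p *\<^sub>R F p z)"
proof (rule unif_bounded_lipschitz_bilinear[OF bounded_bilinear_scaleR])
  assume "bounded P"
  then obtain M where "\<And>p. p \<in> P \<Longrightarrow> norm p \<le> M" using bounded_iff by blast
  then show "unif_bounded_lipschitz P K (\<lambda>p z. p)" by (rule unif_bounded_lipschitz_param)
qed

lemma unif_bounded_lipschitz_Pair [ubl_intros]: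
  assumes "unif_bounded_lipschitz P K F" "unif_bounded_lipschitz P K G"
  shows "unif_bounded_lipschitz P K (\<lambda>p z. (F p z, G p z))"
proof -
  have "bounded_linear (\<lambda>x::'c. (x, 0::'d))" "bounded_linear (\<lambda>x::'d. (0::'c, x))"
    by (auto intro!: bounded_linear_Pair bounded_linear_ident bounded_linear_zero)
  from unif_bounded_lipschitz_add[OF unif_bounded_lipschitz_bounded_linear[OF this(1) assms(1)]
      unif_bounded_lipschitz_bounded_linear[OF this(2) assms(2)]]
  show ?thesis by simp
qed

lemma unif_bounded_lipschitz_power_subst:
  fixes X :: "'p \<Rightarrow> 'z::real_normed_vector \<Rightarrow> 'e::euclidean_space \<Rightarrow> 'a::{real_normed_algebra_1, comm_ring_1, banach}"
  assumes c: "abs_conv_radius_ge c (2 * s)" and s: "s > 0"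
    and X: "\<And>b. b \<in> Basis \<Longrightarrow> unif_bounded_lipschitz P K (\<lambda>p z. X p z b)"
      "\<And>p z b. p \<in> P \<Longrightarrow> z \<in> K \<Longrightarrow> b \<in> Basis \<Longrightarrow> norm (X p z b) \<le> s"
  shows "unif_bounded_lipschitz P K (\<lambda>p z. power_subst c (X p z))"
proof -
  have c': "abs_conv_radius_ge c s"
    using abs_conv_radius_ge_mono[OF c, of s] s by simp
  have "\<exists>L. \<forall>p\<in>P. \<forall>z\<in>K. \<forall>w\<in>K. norm (X p z b - X p w b) \<le> L * norm (z - w)" if "b \<in> Basis" for b
    using X(1)[OF that] unfolding unif_bounded_lipschitz_def by blast
  then obtain L where L: "\<And>b p z w. b \<in> Basis \<Longrightarrow> p \<in> P \<Longrightarrow> z \<in> K \<Longrightarrow> w \<in> K \<Longrightarrow>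
      norm (X p z b - X p w b) \<le> L b * norm (z - w)"
    by metis
  let ?C = "\<Sum>\<^sub>\<infinity>\<alpha>\<in>Basis \<rightarrow>\<^sub>E UNIV. \<bar>c \<alpha>\<bar> * (2 * s) ^ (\<Sum>b\<in>Basis. \<alpha> b)"
  show ?thesis
  proof (rule unif_bounded_lipschitzI[where L="?C * (sum L Basis / s)"])
    show "norm (power_subst c (X p z)) \<le> (\<Sum>\<^sub>\<infinity>\<alpha>\<in>Basis \<rightarrow>\<^sub>E UNIV. \<bar>c \<alpha>\<bar> * s ^ (\<Sum>b\<in>Basis. \<alpha> b))"
      if "p \<in> P" "z \<in> K" for p z
      using that X by (intro power_subst_has_sum(2) c') auto
    fix p z w assume pzw: "p \<in> P" "z \<in> K" "w \<in> K"
    have "norm (power_subst c (X p z) - power_subst c (X p w)) \<le> ?C * ((\<Sum>b\<in>Basis. norm (X p z b - X p w b)) / s)"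
      using pzw X by (intro power_subst_lipschitz c s) auto
    also have "\<dots> \<le> ?C * ((\<Sum>b\<in>Basis. L b * norm (z - w)) / s)"
      using pzw L s by (intro mult_left_mono divide_right_mono sum_mono infsum_nonneg) auto
    finally show "norm (power_subst c (X p z) - power_subst c (X p w)) \<le> ?C * (sum L Basis / s) * norm (z - w)"
      unfolding sum_distrib_right[symmetric] by (simp add: mult_ac)
  qed
qed

text \<open>\<open>H\<close> itself depends on \<tau>, so its bound and its Lipschitz constant have
  to be known before \<tau> is chosen.\<close>

lemma unif_bounded_lipschitz_fixpoint:
  fixes H :: "real \<Rightarrow> 'z::banach \<Rightarrow> 'z"
  assumes H: "unif_bounded_lipschitz {0<..\<tau>0} (cball z0 \<delta>) H" and pos: "\<tau>0 > 0" "\<delta> > 0"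
  obtains \<tau> z where "0 < \<tau>" "\<tau> \<le> \<tau>0" "z \<in> cball z0 \<delta>" "z = z0 + \<tau> *\<^sub>R H \<tau> z"
proof -
  obtain M L where bnd: "M \<ge> 0" "L \<ge> 0"
      "\<And>p z. p \<in> {0<..\<tau>0} \<Longrightarrow> z \<in> cball z0 \<delta> \<Longrightarrow> norm (H p z) \<le> M"
      "\<And>p z w. p \<in> {0<..\<tau>0} \<Longrightarrow> z \<in> cball z0 \<delta> \<Longrightarrow> w \<in> cball z0 \<delta> \<Longrightarrow> norm (H p z - H p w) \<le> L * norm (z - w)"
    using unif_bounded_lipschitzE[OF H] by metis
  \<comment> \<open>The three bounds give, in turn, admissibility of \<tau>, invariance of the ball
    and the contraction constant 1/2. Adding 1 to \<open>M\<close> and \<open>L\<close> avoids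
    division by zero.\<close>
  define \<tau> where "\<tau> = Min {\<tau>0, \<delta> / (M + 1), 1 / (2 * (L + 1))}"
  have \<tau>: "0 < \<tau>" "\<tau> \<le> \<tau>0" "\<tau> * M \<le> \<delta>" "\<tau> * L \<le> 1 / 2"
  proof -
    have le: "\<tau> \<le> \<tau>0" "\<tau> \<le> \<delta> / (M + 1)" "\<tau> \<le> 1 / (2 * (L + 1))" unfolding \<tau>_def by (rule Min_le; simp)+
    show "0 < \<tau>" unfolding \<tau>_def using bnd pos by auto
    show "\<tau> \<le> \<tau>0" by fact
    have "\<tau> * (M + 1) \<le> \<delta>" "\<tau> * (2 * (L + 1)) \<le> 1"
      using le bnd by (auto simp: pos_le_divide_eq)
    then show "\<tau> * M \<le> \<delta>" "\<tau> * L \<le> 1 / 2"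
      using \<open>0 < \<tau>\<close> by (auto simp: algebra_simps)
  qed
  have "\<exists>!z\<in>cball z0 \<delta>. z0 + \<tau> *\<^sub>R H \<tau> z = z"
  proof (rule Banach_fix[where c="1/2"])
    show "complete (cball z0 \<delta>)" by (simp add: complete_eq_closed)
    show "cball z0 \<delta> \<noteq> {}" using pos by simp
    show "(\<lambda>z. z0 + \<tau> *\<^sub>R H \<tau> z) ` cball z0 \<delta> \<subseteq> cball z0 \<delta>"
    proof (clarsimp simp: dist_norm)
      fix z assume z: "norm (z0 - z) \<le> \<delta>"
      have "\<tau> * norm (H \<tau> z) \<le> \<tau> * M"
        using \<tau> bnd(3)[of \<tau> z] z by (intro mult_left_mono) (auto simp: dist_norm)
      then have "\<tau> * norm (H \<tau> z) \<le> \<delta>" using \<tau>(3) by linarith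
      then show "\<bar>\<tau>\<bar> * norm (H \<tau> z) \<le> \<delta>" using \<tau>(1) by simp
    qed
    show "dist (z0 + \<tau> *\<^sub>R H \<tau> z) (z0 + \<tau> *\<^sub>R H \<tau> w) \<le> 1 / 2 * dist z w"
      if "z \<in> cball z0 \<delta>" "w \<in> cball z0 \<delta>" for z w
    proof -
      have "dist (z0 + \<tau> *\<^sub>R H \<tau> z) (z0 + \<tau> *\<^sub>R H \<tau> w) = \<tau> * norm (H \<tau> z - H \<tau> w)"
        using \<tau> by (simp add: dist_norm flip: scaleR_diff_right)
      also have "\<dots> \<le> \<tau> * (L * norm (z - w))"
        using \<tau> bnd(4) that by (intro mult_left_mono) auto
      also have "\<dots> \<le> 1 / 2 * norm (z - w)"
        using mult_right_mono[OF \<tau>(4), of "norm (z - w)"] by (simp add: mult.assoc)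
      finally show ?thesis by (simp add: dist_norm)
    qed
  qed auto
  then show thesis using that \<tau> by metis
qed

section \<open>Initial data and gas fields as elements of the algebra\<close>

text \<open>After rescaling by \<open>R\<close>, every non-constant term carries at least one factor
  \<open>R\<close>, which brings the series close to the constant \<open>g 0\<close>. The derivative
  \<open>Q R\<close> is constructed directly, since the x-derivative of an element of the algebra
  may have infinite norm.\<close>

lemma analytic_x_series:
  assumes g: "real_analytic_at g (0::real)"
  obtains R0 C :: real and X Q :: "real \<Rightarrow> diamond_series" where "R0 > 0"
    "\<And>R p. 0 < R \<Longrightarrow> R \<le> R0 \<Longrightarrow> p \<in> diamond 1 1 \<Longrightarrow> ev2 p (X R) = g (R * snd p)"
    "\<And>R i j. 0 < R \<Longrightarrow> R \<le> R0 \<Longrightarrow> coeff2 (X R) (Suc i, j) = 0"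
    "\<And>R. 0 < R \<Longrightarrow> R \<le> R0 \<Longrightarrow> coeff2 (Q R) = x_deriv_coeffs (coeff2 (X R))"
    "\<And>R. 0 < R \<Longrightarrow> R \<le> R0 \<Longrightarrow> norm (X R - g 0 *\<^sub>R 1) \<le> C * R"
proof -
  obtain r c where r: "r > 0" and c: "\<And>s. \<bar>s\<bar> < r \<Longrightarrow> ((\<lambda>n. c n * s ^ n) has_sum g (0 + s)) UNIV"
    using g unfolding real_analytic_at_real by blast
  define r1 where "r1 = r / 2"
  have r1: "r1 > 0" "r1 < r" using r by (auto simp: r1_def)
  have "(\<lambda>n. c n * r1 ^ n) summable_on UNIV"
    using c[of r1] r1 by (auto dest: has_sum_imp_summable)
  from this[THEN iffD1[OF summable_on_iff_abs_summable_on_real]]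
  have abs1: "(\<lambda>n. \<bar>c n\<bar> * r1 ^ n) summable_on UNIV"
    using r1 by (simp add: abs_mult)
  have abs: "(\<lambda>n. \<bar>c n * R ^ n\<bar>) summable_on UNIV" if "0 < R" "R \<le> r1" for R
    by (rule summable_on_comparison_test[OF abs1])
      (use that in \<open>auto simp: abs_mult intro!: mult_left_mono power_mono\<close>)
  have "((\<lambda>n. c n * 0 ^ n) has_sum c 0) UNIV"
    by (rule has_sum_finite_neutralI[of "{0}"]) auto
  then have c0: "c 0 = g 0"
    using c[of 0] r has_sum_unique by fastforce
  define X where "X R = x_series (\<lambda>n. c n * R ^ n)" for R
  define Q where "Q R = x_series (\<lambda>n. real (Suc n) * (c (Suc n) * R ^ Suc n))" for R
  \<comment> \<open>The restriction to half of \<open>r1\<close> leaves a factor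
    \<open>2 ^ Suc n\<close>, which absorbs the factor \<open>Suc n\<close> from
    differentiation.\<close>
  have absQ: "(\<lambda>n. \<bar>real (Suc n) * (c (Suc n) * R ^ Suc n)\<bar>) summable_on UNIV" if R: "0 < R" "R \<le> r1 / 2" for R
  proof -
    have "(\<lambda>n. \<bar>c n\<bar> * r1 ^ n) summable_on range Suc"
      using abs1 summable_on_subset_banach by blast
    then have "(\<lambda>n. \<bar>c (Suc n)\<bar> * r1 ^ Suc n) summable_on UNIV"
      using summable_on_reindex[of Suc UNIV "\<lambda>n. \<bar>c n\<bar> * r1 ^ n"] by (simp add: o_def)
    then show ?thesis
    proof (rule summable_on_comparison_test)
      fix n
      have "real (Suc n) * R ^ Suc n \<le> 2 ^ Suc n * R ^ Suc n"
        using R of_nat_less_two_power[of "Suc n", where 'a=real] by (intro mult_right_mono) auto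
      also have "\<dots> = (2 * R) ^ Suc n" by (simp only: power_mult_distrib)
      also have "\<dots> \<le> r1 ^ Suc n"
        using R by (intro power_mono) auto
      finally have "\<bar>c (Suc n)\<bar> * (real (Suc n) * R ^ Suc n) \<le> \<bar>c (Suc n)\<bar> * r1 ^ Suc n"
        by (intro mult_left_mono) auto
      then show "\<bar>real (Suc n) * (c (Suc n) * R ^ Suc n)\<bar> \<le> \<bar>c (Suc n)\<bar> * r1 ^ Suc n"
        using R by (simp add: abs_mult mult_ac del: of_nat_Suc)
    qed auto
  qed
  have cX: "coeff2 (X R) = (\<lambda>(i, j). if i = 0 then c j * R ^ j else 0)" if "0 < R" "R \<le> r1" for R
    unfolding X_def by (rule coeff2_x_series[OF has_sum_infsum[OF abs[OF that]]])
  show thesis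
  proof (rule that[of "r1 / 2" X Q "(\<Sum>\<^sub>\<infinity>n. \<bar>c n\<bar> * r1 ^ n) / r1"])
    show "r1 / 2 > 0" using r1 by simp
    fix R :: real assume R: "0 < R" "R \<le> r1 / 2"
    then have R1: "R \<le> r1" by simp
    show "coeff2 (X R) (Suc i, j) = 0" for i j by (simp add: cX[OF R(1) R1])
    show "ev2 p (X R) = g (R * snd p)" if p: "p \<in> diamond 1 1" for p
      unfolding X_def
    proof (rule ev2_x_series[OF p abs[OF R(1) R1]])
      have "0 \<le> \<bar>fst p\<bar>" by simp
      then have "\<bar>snd p\<bar> < 1" using p unfolding diamond_def by (simp add: case_prod_unfold)
      then have "\<bar>R * snd p\<bar> \<le> R * 1" using R unfolding abs_mult by (intro mult_mono) auto
      then show "((\<lambda>j. c j * R ^ j * snd p ^ j) has_sum g (R * snd p)) UNIV"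
        using c[of "R * snd p"] R1 r1 by (simp add: power_mult_distrib mult.assoc)
    qed
    show "coeff2 (Q R) = x_deriv_coeffs (coeff2 (X R))"
      unfolding Q_def coeff2_x_series[OF has_sum_infsum[OF absQ[OF R]]] cX[OF R(1) R1]
      by (auto simp: x_deriv_coeffs_def)
    \<comment> \<open>Without its constant term the series gains the factor R / r1, because R^n
      \<le> r1^n (R / r1) for n \<ge> 1. This is the origin of the constant supplied for
      \<open>C\<close>.\<close>
    define d where "d n = (if n = 0 then 0 else c n * R ^ n)" for n
    have dle: "\<bar>d n\<bar> \<le> \<bar>c n\<bar> * r1 ^ n * (R / r1)" for n
    proof (cases n)
      case (Suc m)
      have "R ^ m \<le> r1 ^ m" using R R1 by (intro power_mono) auto
      then have "\<bar>c n\<bar> * R * R ^ m \<le> \<bar>c n\<bar> * R * r1 ^ m" using R by (intro mult_left_mono) auto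
      then show ?thesis using Suc r1 R by (simp add: d_def abs_mult mult_ac)
    qed (use R r1 in \<open>simp add: d_def\<close>)
    have dsum: "(\<lambda>n. \<bar>d n\<bar>) summable_on UNIV"
      by (rule summable_on_comparison_test[OF summable_on_cmult_left[OF abs1, of "R / r1"]]) (use dle in auto)
    have "X R - g 0 *\<^sub>R 1 = x_series d"
      by (rule diamond_eqI)
        (simp add: cX[OF R(1) R1] coeff2_x_series[OF has_sum_infsum[OF dsum]] d_def c0)
    then have "norm (X R - g 0 *\<^sub>R 1) = infsum (\<lambda>n. \<bar>d n\<bar>) UNIV"
      using norm_x_series[OF has_sum_infsum[OF dsum]] by simp
    also have "\<dots> \<le> infsum (\<lambda>n. \<bar>c n\<bar> * r1 ^ n * (R / r1)) UNIV"
      by (rule infsum_mono[OF dsum summable_on_cmult_left[OF abs1] dle])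
    also have "\<dots> = (\<Sum>\<^sub>\<infinity>n. \<bar>c n\<bar> * r1 ^ n) / r1 * R"
      by (subst infsum_cmult_left') simp
    finally show "norm (X R - g 0 *\<^sub>R 1) \<le> (\<Sum>\<^sub>\<infinity>n. \<bar>c n\<bar> * r1 ^ n) / r1 * R" .
  qed
qed

lemma ev2_sum: "p \<in> diamond 1 1 \<Longrightarrow> ev2 p (\<Sum>k\<in>A. F k) = (\<Sum>k\<in>A. ev2 p (F k))"
  using bounded_linear.linear[OF bounded_linear_ev2] by (rule linear_sum)

text \<open>
  In the next two predicates \<open>\<Psi>\<close> realises \<open>1 / Z\<close> for \<open>Z\<close> near the constant \<open>a\<close>, and \<open>\<Phi>\<close>
  realises the composition \<open>f (T, Y)\<close>, in the algebra.
\<close>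

definition diamond_inverse_ok :: "real \<Rightarrow> real \<Rightarrow> (diamond_series \<Rightarrow> diamond_series) \<Rightarrow> bool"
  where "diamond_inverse_ok s a \<Psi> \<longleftrightarrow>
    (\<forall>p\<in>diamond 1 1. \<forall>Z. norm (Z - a *\<^sub>R 1) \<le> s \<longrightarrow> ev2 p Z \<noteq> 0 \<and> ev2 p (\<Psi> Z) = 1 / ev2 p Z) \<and>
    (\<forall>(P :: real set) (K :: (diamond_series \<times> diamond_series \<times> diamond_series) set) Z.
      unif_bounded_lipschitz P K Z \<longrightarrow> (\<forall>p\<in>P. \<forall>z\<in>K. norm (Z p z - a *\<^sub>R 1) \<le> s) \<longrightarrow>
      unif_bounded_lipschitz P K (\<lambda>p z. \<Psi> (Z p z)))"

text \<open>Geometric series in - x / a, convergent for |x| < a.\<close>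

lemma real_analytic_at_shifted_inverse:
  assumes "a > (0::real)"
  shows "real_analytic_at (\<lambda>x. 1 / (a + x)) 0"
  unfolding real_analytic_at_real
proof (intro exI[of _ a] conjI assms exI[of _ "\<lambda>n. (1 / a) * (- 1 / a) ^ n"] allI impI)
  fix s :: real assume s: "\<bar>s\<bar> < a"
  define q where "q = - s / a"
  have q: "norm q < 1" using s assms by (simp add: q_def)
  have "(\<lambda>n. norm (q ^ n)) sums (1 / (1 - norm q))"
    using geometric_sums[of "norm q"] q by (simp add: power_abs)
  then have "((\<lambda>n. q ^ n) has_sum (1 / (1 - q))) UNIV"
    using geometric_sums[OF q] by (intro norm_summable_imp_has_sum) (auto dest: sums_summable)
  then have "((\<lambda>n. 1 / a * q ^ n) has_sum (1 / a * (1 / (1 - q)))) UNIV"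
    by (rule has_sum_cmult_right)
  moreover have "1 / a * q ^ n = 1 / a * (- 1 / a) ^ n * s ^ n" for n
  proof -
    have "q = (- 1 / a) * s" by (simp add: q_def)
    then show ?thesis by (simp only: power_mult_distrib mult.assoc)
  qed
  moreover have "1 / a * (1 / (1 - q)) = 1 / (a + (0 + s))"
    using s assms by (simp add: q_def field_simps)
  ultimately show "((\<lambda>n. 1 / a * (- 1 / a) ^ n * s ^ n) has_sum 1 / (a + (0 + s))) UNIV"
    by (simp only:)
qed

lemma diamond_inverse_ok_exists:
  assumes a: "a > 0"
  shows "\<exists>s>0. \<exists>\<Psi>. diamond_inverse_ok s a \<Psi>"
proof -
  obtain s1 c where s1: "s1 > 0" "abs_conv_radius_ge c s1" and
    sum: "\<And>x. (\<And>b. b \<in> Basis \<Longrightarrow> \<bar>x \<bullet> b\<bar> \<le> s1) \<Longrightarrow>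
      ((\<lambda>\<alpha>. c \<alpha> * (\<Prod>b\<in>Basis. (x \<bullet> b) ^ \<alpha> b)) has_sum 1 / (a + x)) (Basis \<rightarrow>\<^sub>E UNIV)"
    using real_analytic_at_0_radius[OF real_analytic_at_shifted_inverse[OF a]] by blast
  \<comment> \<open>Half of \<open>s1\<close> is what the Lipschitz estimate for substitution asks
    for; \<open>a / 2\<close> keeps every value of \<open>Z\<close> away from zero.\<close>
  define s where "s = min (s1 / 2) (a / 2)"
  have s: "s > 0" "2 * s \<le> s1" "s < a" using s1 a by (auto simp: s_def)
  have c2: "abs_conv_radius_ge c (2 * s)" and c1: "abs_conv_radius_ge c s"
    using abs_conv_radius_ge_mono[OF s1(2)] s by auto
  define \<Psi> where "\<Psi> Z = power_subst c (\<lambda>b. b *\<^sub>R (Z - a *\<^sub>R 1 :: diamond_series))" for Z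
  have "ev2 p Z \<noteq> 0 \<and> ev2 p (\<Psi> Z) = 1 / ev2 p Z" if p: "p \<in> diamond 1 1" and Z: "norm (Z - a *\<^sub>R 1) \<le> s" for p Z
  proof
    have "\<bar>ev2 p Z - a\<bar> \<le> s"
      using abs_ev2_le[OF p, of "Z - a *\<^sub>R 1"] Z p by simp
    then show "ev2 p Z \<noteq> 0" using s by auto
    have "ev2 p (\<Psi> Z) = 1 / (a + (ev2 p Z - a))"
      unfolding \<Psi>_def
    proof (rule ev2_power_subst[where f="\<lambda>x. 1 / (a + x)" and x="ev2 p Z - a", OF p c1])
      show "((\<lambda>\<alpha>. c \<alpha> * (\<Prod>b\<in>Basis. (x \<bullet> b) ^ \<alpha> b)) has_sum 1 / (a + x)) (Basis \<rightarrow>\<^sub>E UNIV)"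
        if "\<And>b. b \<in> Basis \<Longrightarrow> \<bar>x \<bullet> b\<bar> \<le> s" for x :: real
        by (rule sum) (use that s in force)
    qed (use p Z in auto)
    then show "ev2 p (\<Psi> Z) = 1 / ev2 p Z" by simp
  qed
  moreover have "unif_bounded_lipschitz P K (\<lambda>p z. \<Psi> (Z p z))"
    if "unif_bounded_lipschitz P K Z" "\<forall>p\<in>P. \<forall>z\<in>K. norm (Z p z - a *\<^sub>R 1) \<le> s"
    for P :: "real set" and K :: "(diamond_series \<times> diamond_series \<times> diamond_series) set" and Z
    unfolding \<Psi>_def
    by (rule unif_bounded_lipschitz_power_subst[OF c2 s(1)]) (use that in \<open>auto intro!: ubl_intros\<close>)
  ultimately have "diamond_inverse_ok s a \<Psi>"
    unfolding diamond_inverse_ok_def by blast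
  with s(1) show ?thesis by blast
qed

definition diamond_subst_ok :: "real \<Rightarrow> (real \<times> (real ^ 'n) \<Rightarrow> real) \<Rightarrow>
    (diamond_series \<Rightarrow> ('n \<Rightarrow> diamond_series) \<Rightarrow> diamond_series) \<Rightarrow> bool"
  where "diamond_subst_ok s f \<Phi> \<longleftrightarrow>
    (\<forall>p\<in>diamond 1 1. \<forall>T Y. norm T \<le> s \<longrightarrow> (\<forall>k. norm (Y k) \<le> s) \<longrightarrow>
      ev2 p (\<Phi> T Y) = f (ev2 p T, \<chi> k. ev2 p (Y k))) \<and>
    (\<forall>(P :: real set) (K :: (diamond_series \<times> diamond_series \<times> diamond_series) set) T Y.
      unif_bounded_lipschitz P K T \<longrightarrow> (\<forall>k. unif_bounded_lipschitz P K (\<lambda>p z. Y p z k)) \<longrightarrow>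
      (\<forall>p\<in>P. \<forall>z\<in>K. norm (T p z) \<le> s \<and> (\<forall>k. norm (Y p z k) \<le> s)) \<longrightarrow>
      unif_bounded_lipschitz P K (\<lambda>p z. \<Phi> (T p z) (Y p z)))"

lemma diamond_subst_ok_mono: "diamond_subst_ok s f \<Phi> \<Longrightarrow> r \<le> s \<Longrightarrow> diamond_subst_ok r f \<Phi>"
  unfolding diamond_subst_ok_def by (meson order_trans)

lemma unif_bounded_lipschitz_sum:
  "(\<And>k. k \<in> A \<Longrightarrow> unif_bounded_lipschitz P K (\<lambda>p z. F p z k)) \<Longrightarrow>
    unif_bounded_lipschitz P K (\<lambda>p z. \<Sum>k\<in>A. F p z k)"
  by (induction A rule: infinite_finite_induct) (auto intro: ubl_intros)

lemma diamond_subst_ok_exists: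
  fixes f :: "real \<times> (real ^ 'n) \<Rightarrow> real"
  assumes f: "real_analytic_at f (0, 0)"
  shows "\<exists>s>0. \<exists>\<Phi>. diamond_subst_ok s f \<Phi>"
proof -
  have f0: "real_analytic_at f 0" using f by (simp add: zero_prod_def)
  obtain s1 c where s1: "s1 > 0" "abs_conv_radius_ge c s1" and
    sum: "\<And>x. (\<And>b. b \<in> Basis \<Longrightarrow> \<bar>x \<bullet> b\<bar> \<le> s1) \<Longrightarrow>
      ((\<lambda>\<alpha>. c \<alpha> * (\<Prod>b\<in>Basis. (x \<bullet> b) ^ \<alpha> b)) has_sum f x) (Basis \<rightarrow>\<^sub>E UNIV)"
    using real_analytic_at_0_radius[OF f0] by blast
  define s where "s = s1 / 2"
  have s: "s > 0" "2 * s = s1" "s \<le> s1" using s1 by (auto simp: s_def)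
  have c2: "abs_conv_radius_ge c (2 * s)" and c1: "abs_conv_radius_ge c s"
    using abs_conv_radius_ge_mono[OF s1(2)] s by auto
  \<comment> \<open>A formula linear in \<open>b\<close> that assigns \<open>T\<close> to the time
    direction and \<open>Y k\<close> to the k-th space direction. Written this way, evaluation and
    Lipschitz bounds are checked for all \<open>b\<close> at once.\<close>
  define X where "X T Y b = fst b *\<^sub>R T + (\<Sum>k\<in>UNIV. (snd b $ k) *\<^sub>R Y k)"
    for T :: diamond_series and Y :: "'n \<Rightarrow> diamond_series" and b :: "real \<times> (real ^ 'n)"
  define \<Phi> where "\<Phi> T Y = power_subst c (X T Y)" for T Y
  have X: "norm (X T Y b) \<le> s" if "b \<in> Basis" "norm T \<le> s" "\<And>k. norm (Y k) \<le> s" for T Y b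
  proof -
    have "b = (1, 0) \<or> (\<exists>k. b = (0, axis k 1))"
      using that(1) by (auto simp: Basis_prod_def Basis_vec_def)
    then show ?thesis
    proof (elim disjE exE)
      assume "b = (1, 0)" then show ?thesis using that by (simp add: X_def)
    next
      fix k assume "b = (0, axis k 1)"
      then have "X T Y b = (\<Sum>j\<in>UNIV. (axis k 1 $ j) *\<^sub>R Y j)"
        by (simp add: X_def)
      also have "\<dots> = (\<Sum>j\<in>UNIV. if j = k then Y k else 0)"
        by (intro sum.cong refl) (auto simp: axis_def)
      finally have "X T Y b = (\<Sum>j\<in>UNIV. if j = k then Y k else 0)" .
      then show ?thesis using that by simp
    qed
  qed
  have "ev2 p (\<Phi> T Y) = f (ev2 p T, \<chi> k. ev2 p (Y k))"
    if p: "p \<in> diamond 1 1" and TY: "norm T \<le> s" "\<And>k. norm (Y k) \<le> s" for p T Y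
    unfolding \<Phi>_def
  proof (rule ev2_power_subst[OF p c1])
    show "norm (X T Y b) \<le> s" if "b \<in> Basis" for b using X that TY by blast
    show "ev2 p (X T Y b) = (ev2 p T, \<chi> k. ev2 p (Y k)) \<bullet> b" for b
      using p by (simp add: X_def ev2_sum inner_prod_def inner_vec_def mult.commute)
    show "((\<lambda>\<alpha>. c \<alpha> * (\<Prod>b\<in>Basis. (x \<bullet> b) ^ \<alpha> b)) has_sum f x) (Basis \<rightarrow>\<^sub>E UNIV)"
      if "\<And>b. b \<in> Basis \<Longrightarrow> \<bar>x \<bullet> b\<bar> \<le> s" for x
      by (rule sum) (use that s in force)
  qed
  moreover have "unif_bounded_lipschitz P K (\<lambda>p z. \<Phi> (T p z) (Y p z))"
    if T: "unif_bounded_lipschitz P K T" and Y: "\<And>k. unif_bounded_lipschitz P K (\<lambda>p z. Y p z k)"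
      and le: "\<forall>p\<in>P. \<forall>z\<in>K. norm (T p z) \<le> s \<and> (\<forall>k. norm (Y p z k) \<le> s)"
    for P :: "real set" and K :: "(diamond_series \<times> diamond_series \<times> diamond_series) set" and T Y
    unfolding \<Phi>_def
  proof (rule unif_bounded_lipschitz_power_subst[OF c2 s(1)])
    show "unif_bounded_lipschitz P K (\<lambda>p z. X (T p z) (Y p z) b)" for b
      unfolding X_def by (intro ubl_intros unif_bounded_lipschitz_sum T Y)
    show "norm (X (T p z) (Y p z) b) \<le> s" if "p \<in> P" "z \<in> K" "b \<in> Basis" for p z b
      using le that by (intro X) auto
  qed
  ultimately have "diamond_subst_ok s f \<Phi>"
    unfolding diamond_subst_ok_def by blast
  with s(1) show ?thesis by blast
qed

section \<open>Return to the original time and space scales\<close>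

definition scaled_ev2 :: "real \<Rightarrow> real \<Rightarrow> diamond_series \<Rightarrow> real \<times> real \<Rightarrow> real"
  where "scaled_ev2 \<tau> r f = (\<lambda>(t, x). ev2 (t / \<tau>, x / r) f)"

definition scaled_coeffs :: "real \<Rightarrow> real \<Rightarrow> diamond_series \<Rightarrow> nat \<times> nat \<Rightarrow> real"
  where "scaled_coeffs \<tau> r f = (\<lambda>(i, j). coeff2 f (i, j) / (\<tau> ^ i * r ^ j))"

lemma scaled_ev2_eq_series2: "scaled_ev2 \<tau> r f = (\<lambda>(t, x). series2 (scaled_coeffs \<tau> r f) t x)"
  by (auto simp: scaled_ev2_def ev2_def series2_def scaled_coeffs_def power_divide fun_eq_iff intro!: infsum_cong)

lemma open_diamond: "open (diamond \<tau> r)"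
proof -
  have "diamond \<tau> r = {q. \<bar>fst q\<bar> / \<tau> + \<bar>snd q\<bar> / r < 1}"
    by (auto simp: diamond_def)
  also have "open \<dots>"
    unfolding divide_inverse by (intro open_Collect_less continuous_intros)
  finally show ?thesis .
qed

context
  fixes \<tau> r :: real
  assumes pos: "\<tau> > 0" "r > 0"
begin

lemma scaled_in_diamond: "(t, x) \<in> diamond \<tau> r \<Longrightarrow> (t / \<tau>, x / r) \<in> diamond 1 1"
  using pos by (simp add: diamond_def)

lemma convergent2_scaled: "convergent2 (scaled_coeffs \<tau> r f) (diamond \<tau> r)"
  unfolding convergent2_def
proof clarify
  fix t x assume "(t, x) \<in> diamond \<tau> r"
  from convergent2D(1)[OF convergent2_coeff2 scaled_in_diamond[OF this], of f]
  show "(\<lambda>(i, j). \<bar>scaled_coeffs \<tau> r f (i, j)\<bar> * \<bar>t\<bar> ^ i * \<bar>x\<bar> ^ j) summable_on UNIV"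
    using pos by (simp add: scaled_coeffs_def power_divide abs_mult)
qed

lemma real_analytic_scaled_ev2: "p \<in> diamond \<tau> r \<Longrightarrow> real_analytic_at (scaled_ev2 \<tau> r f) p"
  unfolding scaled_ev2_eq_series2 by (rule real_analytic_at_series2[OF open_diamond convergent2_scaled])

lemma scaled_ev2_t_derivative:
  assumes "\<And>i j. real (Suc i) * coeff2 f (Suc i, j) = \<tau> * coeff2 g (i, j)" "(t, x) \<in> diamond \<tau> r"
  shows "((\<lambda>s. scaled_ev2 \<tau> r f (s, x)) has_vector_derivative scaled_ev2 \<tau> r g (t, x)) (at t)"
proof -
  have "t_deriv_coeffs (scaled_coeffs \<tau> r f) = scaled_coeffs \<tau> r g"
    using pos assms(1) by (auto simp: t_deriv_coeffs_def scaled_coeffs_def fun_eq_iff simp del: of_nat_Suc)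
  then show ?thesis
    using partial_t_series2[OF open_diamond convergent2_scaled assms(2), of f] by (simp add: scaled_ev2_eq_series2)
qed

lemma scaled_ev2_x_derivative:
  assumes "\<And>i j. real (Suc j) * coeff2 f (i, Suc j) = r * coeff2 g (i, j)" "(t, x) \<in> diamond \<tau> r"
  shows "((\<lambda>s. scaled_ev2 \<tau> r f (t, s)) has_vector_derivative scaled_ev2 \<tau> r g (t, x)) (at x)"
proof -
  have "x_deriv_coeffs (scaled_coeffs \<tau> r f) = scaled_coeffs \<tau> r g"
    using pos assms(1) by (auto simp: x_deriv_coeffs_def scaled_coeffs_def fun_eq_iff simp del: of_nat_Suc)
  then show ?thesis
    using partial_x_series2[OF open_diamond convergent2_scaled assms(2), of f] by (simp add: scaled_ev2_eq_series2)
qed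

text \<open>The common derivative is only asserted to exist, because the x-derivative of
  \<open>g\<close> may lie outside the algebra. Equality of the two differentiated coefficient
  families is enough.\<close>

lemma scaled_ev2_mixed_derivative:
  assumes "\<And>i j. r * real (Suc i) * coeff2 f (Suc i, j) = \<tau> * real (Suc j) * coeff2 g (i, Suc j)" "(t, x) \<in> diamond \<tau> r"
  shows "\<exists>d. ((\<lambda>s. scaled_ev2 \<tau> r f (s, x)) has_vector_derivative d) (at t) \<and>
    ((\<lambda>s. scaled_ev2 \<tau> r g (t, s)) has_vector_derivative d) (at x)"
proof -
  have "t_deriv_coeffs (scaled_coeffs \<tau> r f) = x_deriv_coeffs (scaled_coeffs \<tau> r g)"
    using pos assms(1)
    by (auto simp: t_deriv_coeffs_def x_deriv_coeffs_def scaled_coeffs_def fun_eq_iff field_simps simp del: of_nat_Suc)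
  then show ?thesis
    using partial_x_series2[OF open_diamond convergent2_scaled assms(2), of g]
      partial_t_series2[OF open_diamond convergent2_scaled assms(2), of f]
    by (auto simp: scaled_ev2_eq_series2)
qed

end

section \<open>The fixed point\<close>

text \<open>
  \<open>X\<close> represents \<open>g (r * x)\<close> and \<open>Q\<close> its derivative in \<open>x\<close>; the bound \<open>\<epsilon>\<close> is reached by shrinking \<open>r\<close>.
\<close>

definition diamond_initial_datum :: "(real \<Rightarrow> real) \<Rightarrow> real \<Rightarrow> real \<Rightarrow> diamond_series \<Rightarrow> diamond_series \<Rightarrow> bool"
  where "diamond_initial_datum g r \<epsilon> X Q \<longleftrightarrow>
    (\<forall>p\<in>diamond 1 1. ev2 p X = g (r * snd p)) \<and> (\<forall>i j. coeff2 X (Suc i, j) = 0) \<and>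
    coeff2 Q = x_deriv_coeffs (coeff2 X) \<and> norm (X - g 0 *\<^sub>R 1) \<le> \<epsilon>"

text \<open>Stated for all sufficiently small \<open>r\<close>, so that finitely many data can share
  one \<open>r\<close>.\<close>

lemma diamond_initial_datum_exists:
  assumes "real_analytic_at g 0" "\<epsilon> > 0"
  shows "\<forall>\<^sub>F r in at_right 0. \<exists>X Q. diamond_initial_datum g r \<epsilon> X Q"
  using assms(1)
proof (rule analytic_x_series)
  fix R0 C :: real and X Q
  assume X: "R0 > 0"
    "\<And>R p. 0 < R \<Longrightarrow> R \<le> R0 \<Longrightarrow> p \<in> diamond 1 1 \<Longrightarrow> ev2 p (X R) = g (R * snd p)"
    "\<And>R i j. 0 < R \<Longrightarrow> R \<le> R0 \<Longrightarrow> coeff2 (X R) (Suc i, j) = 0"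
    "\<And>R. 0 < R \<Longrightarrow> R \<le> R0 \<Longrightarrow> coeff2 (Q R) = x_deriv_coeffs (coeff2 (X R))"
    "\<And>R. 0 < R \<Longrightarrow> R \<le> R0 \<Longrightarrow> norm (X R - g 0 *\<^sub>R 1) \<le> C * R"
  have "diamond_initial_datum g R \<epsilon> (X R) (Q R)" if R: "0 < R" "R < min R0 (\<epsilon> / (\<bar>C\<bar> + 1))" for R
  proof -
    have "C * R \<le> (\<bar>C\<bar> + 1) * R" using R by (intro mult_right_mono) auto
    also have "\<dots> \<le> \<epsilon>" using R by (simp add: pos_less_divide_eq mult.commute)
    finally show ?thesis
      using X(2-4)[of R] X(5)[of R] R unfolding diamond_initial_datum_def by auto
  qed
  moreover have "min R0 (\<epsilon> / (\<bar>C\<bar> + 1)) > 0"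
    using X(1) assms(2) by (simp add: divide_pos_pos add_nonneg_pos)
  ultimately show "\<forall>\<^sub>F r in at_right 0. \<exists>X Q. diamond_initial_datum g r \<epsilon> X Q"
    unfolding eventually_at_right_field by blast
qed

lemma diamond_subst_ok_eventually:
  fixes f :: "real \<times> (real ^ 'n) \<Rightarrow> real"
  assumes f: "real_analytic_at f (0, 0)"
  shows "\<forall>\<^sub>F s in at_right 0. \<exists>\<Phi>. diamond_subst_ok s f \<Phi>"
proof -
  obtain s0 \<Phi> where "s0 > 0" "diamond_subst_ok s0 f \<Phi>"
    using diamond_subst_ok_exists[OF f] by blast
  then show ?thesis
    unfolding eventually_at_right_field using diamond_subst_ok_mono[of s0 f \<Phi>] less_imp_le by blast
qed

lemma has_vector_derivative_vec:
  fixes f :: "real \<Rightarrow> real ^ 'n"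
  assumes "\<And>k. ((\<lambda>s. f s $ k) has_vector_derivative d $ k) (at t)"
  shows "(f has_vector_derivative d) (at t)"
  unfolding has_vector_derivative_def
proof (subst has_derivative_componentwise_within, rule ballI)
  fix i :: "real ^ 'n" assume "i \<in> Basis"
  then obtain k where "i = axis k 1" by (auto simp: Basis_vec_def)
  then show "((\<lambda>s. f s \<bullet> i) has_derivative (\<lambda>x. x *\<^sub>R d \<bullet> i)) (at t)"
    using assms[of k] by (simp add: inner_axis has_vector_derivative_def)
qed

text \<open>The fixed point is a triple, two velocity components and the density; position and slope
  are functions of the velocity. The data use up only half of the radii \<open>s\<close> and
  \<open>e\<close>, and the other half is left for the deviation from the data.\<close>

lemma diamond_system_solution:
  fixes Y0 V0 P0 :: "2 \<Rightarrow> diamond_series" and E0 :: diamond_series and a s e r :: real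
    and \<rho>p \<rho>m :: "real \<times> (real ^ 2) \<Rightarrow> real" and vp vm :: "real \<times> (real ^ 2) \<Rightarrow> real ^ 2"
  assumes s: "s > 0" and e: "e > 0"
    and Rp: "diamond_subst_ok s \<rho>p Rp" and Rm: "diamond_subst_ok s \<rho>m Rm"
    and Up: "\<And>k. diamond_subst_ok s (\<lambda>q. vp q $ k) (Up k)" and Um: "\<And>k. diamond_subst_ok s (\<lambda>q. vm q $ k) (Um k)"
    and inv: "diamond_inverse_ok e a \<Psi>"
    and Y0: "\<And>k. norm (Y0 k) \<le> s / 2" and E0: "norm (E0 - a *\<^sub>R 1) \<le> e / 2"
  obtains \<tau> V Y P E F G Qp Qm where "\<tau> > 0" "\<tau> \<le> s" "\<And>k. norm (Y k) \<le> s" "norm (E - a *\<^sub>R 1) \<le> e"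
    "\<And>k. Y k = Y0 k + \<tau> *\<^sub>R t_integral (V k)"
    "\<And>k. P k = (1 / r) *\<^sub>R (P0 k + \<tau> *\<^sub>R x_deriv_t_integral (V k))"
    "\<And>k. V k = V0 k + \<tau> *\<^sub>R t_integral (G k)"
    "E = E0 + \<tau> *\<^sub>R t_integral F"
    "Qp = (P 1 * (V 2 - Up 2 (\<tau> *\<^sub>R t_var) Y) - P 2 * (V 1 - Up 1 (\<tau> *\<^sub>R t_var) Y)) * Rp (\<tau> *\<^sub>R t_var) Y"
    "Qm = (P 1 * (V 2 - Um 2 (\<tau> *\<^sub>R t_var) Y) - P 2 * (V 1 - Um 1 (\<tau> *\<^sub>R t_var) Y)) * Rm (\<tau> *\<^sub>R t_var) Y"
    "F = Qp - Qm"
    "\<And>k. G k = Qp * ((Up k (\<tau> *\<^sub>R t_var) Y - V k) * \<Psi> E) - Qm * ((Um k (\<tau> *\<^sub>R t_var) Y - V k) * \<Psi> E)"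
proof -
  \<comment> \<open>The centre is the solution for \<tau> = 0, and the radius e / 2 keeps the
    density within \<open>e\<close> of the constant \<open>a\<close>.\<close>
  define z0 where "z0 = (V0 1, V0 2, E0)"
  define \<delta> where "\<delta> = e / 2"
  define K where "K = cball z0 \<delta>"
  define M where "M = norm z0 + \<delta>"
  have \<delta>: "\<delta> > 0" and M: "M \<ge> 0" using e by (auto simp: \<delta>_def M_def)
  \<comment> \<open>The bound \<open>s\<close> keeps the time argument, of norm \<tau>, inside the
    radius of substitution. As \<open>M\<close> bounds the norm on the ball, the second bound keeps
    the displacement \<tau> \<integral> v below s / 2.\<close>
  define \<tau>0 where "\<tau>0 = min s (s / (2 * (M + 1)))"
  have \<tau>0: "\<tau>0 > 0" "\<tau>0 \<le> s" "\<tau>0 * M \<le> s / 2"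
  proof -
    show "\<tau>0 > 0" "\<tau>0 \<le> s" using s M by (auto simp: \<tau>0_def)
    have "\<tau>0 \<le> s / (2 * (M + 1))" by (simp add: \<tau>0_def)
    then have "\<tau>0 * (2 * (M + 1)) \<le> s" using M by (simp add: pos_le_divide_eq)
    then show "\<tau>0 * M \<le> s / 2" using \<open>\<tau>0 > 0\<close> by (simp add: algebra_simps)
  qed
  let ?P = "{0<..\<tau>0}"
  let ?ubl = "unif_bounded_lipschitz ?P K"
  define V where "V z k = (if k = 1 then fst z else fst (snd z))"
    for z :: "diamond_series \<times> diamond_series \<times> diamond_series" and k :: 2
  define E where "E z = snd (snd z)" for z :: "diamond_series \<times> diamond_series \<times> diamond_series"
  define Y where "Y \<tau> z k = Y0 k + \<tau> *\<^sub>R t_integral (V z k)" for \<tau> z k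
  define P where "P \<tau> z k = (1 / r) *\<^sub>R (P0 k + \<tau> *\<^sub>R x_deriv_t_integral (V z k))" for \<tau> z k
  define Qp where "Qp \<tau> z = (P \<tau> z 1 * (V z 2 - Up 2 (\<tau> *\<^sub>R t_var) (Y \<tau> z))
    - P \<tau> z 2 * (V z 1 - Up 1 (\<tau> *\<^sub>R t_var) (Y \<tau> z))) * Rp (\<tau> *\<^sub>R t_var) (Y \<tau> z)" for \<tau> z
  define Qm where "Qm \<tau> z = (P \<tau> z 1 * (V z 2 - Um 2 (\<tau> *\<^sub>R t_var) (Y \<tau> z))
    - P \<tau> z 2 * (V z 1 - Um 1 (\<tau> *\<^sub>R t_var) (Y \<tau> z))) * Rm (\<tau> *\<^sub>R t_var) (Y \<tau> z)" for \<tau> z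
  define F where "F \<tau> z = Qp \<tau> z - Qm \<tau> z" for \<tau> z
  define G where "G \<tau> z k = Qp \<tau> z * ((Up k (\<tau> *\<^sub>R t_var) (Y \<tau> z) - V z k) * \<Psi> (E z))
    - Qm \<tau> z * ((Um k (\<tau> *\<^sub>R t_var) (Y \<tau> z) - V z k) * \<Psi> (E z))" for \<tau> z k
  define H where "H \<tau> z = (t_integral (G \<tau> z 1), t_integral (G \<tau> z 2), t_integral (F \<tau> z))" for \<tau> z
  have bP: "bounded ?P" by simp
  have id: "?ubl (\<lambda>\<tau> z. z)" by (rule unif_bounded_lipschitz_ident) (simp add: K_def)
  have V: "?ubl (\<lambda>\<tau> z. V z k)" for k
    by (cases "k = 1")
      (auto simp: V_def intro!: unif_bounded_lipschitz_bounded_linear[OF _ id]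
        bounded_linear_fst bounded_linear_snd bounded_linear_fst_comp bounded_linear_snd_comp)
  have E: "?ubl (\<lambda>\<tau> z. E z)"
    unfolding E_def by (intro unif_bounded_lipschitz_bounded_linear[OF _ id] bounded_linear_snd_comp bounded_linear_snd)
  note scaled = unif_bounded_lipschitz_scaleR_param[OF bP]
  have T: "?ubl (\<lambda>\<tau> z. \<tau> *\<^sub>R t_var)" by (intro scaled ubl_intros)
  have Y: "?ubl (\<lambda>\<tau> z. Y \<tau> z k)" for k
    unfolding Y_def by (intro ubl_intros scaled unif_bounded_lipschitz_bounded_linear[OF bounded_linear_t_integral] V)
  \<comment> \<open>The derivative in \<open>P\<close> does no harm: it occurs only inside the
    bounded operator \<open>x_deriv_t_integral\<close>, and \<open>1 / r\<close> is independent of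
    \<tau>.\<close>
  have P: "?ubl (\<lambda>\<tau> z. P \<tau> z k)" for k
    unfolding P_def by (intro ubl_intros scaled unif_bounded_lipschitz_bounded_linear[OF bounded_linear_x_deriv_t_integral] V)
  have normz: "norm z \<le> M" if "z \<in> K" for z
    using that norm_triangle_sub[of z z0] by (simp add: K_def M_def dist_norm norm_minus_commute)
  have normfst: "norm (fst x) \<le> norm x" and normsnd: "norm (snd x) \<le> norm x"
    for x :: "'b::real_normed_vector \<times> 'c::real_normed_vector"
    using dist_fst_le[of x 0] dist_snd_le[of x 0] by auto
  have normV: "norm (V z k) \<le> M" if "z \<in> K" for z k
    using normz[OF that] normfst[of z] normsnd[of z] normfst[of "snd z"] by (auto simp: V_def)
  have normY: "norm (Y \<tau> z k) \<le> s" if "\<tau> \<in> ?P" "z \<in> K" for \<tau> z k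
  proof -
    have "norm (\<tau> *\<^sub>R t_integral (V z k)) \<le> \<tau>0 * M"
      using that norm_t_integral_le[of "V z k"] normV[OF that(2), of k] M by (auto intro!: mult_mono)
    then show ?thesis
      using norm_triangle_mono[OF Y0[of k], of "\<tau> *\<^sub>R t_integral (V z k)" "s / 2"] \<tau>0 by (simp add: Y_def)
  qed
  have normT: "norm (\<tau> *\<^sub>R t_var) \<le> s" if "\<tau> \<in> ?P" for \<tau>
    using that \<tau>0 by (simp add: norm_t_var)
  have normE: "norm (E z - a *\<^sub>R 1) \<le> e" if "z \<in> K" for z
  proof -
    have "norm (snd (snd (z - z0))) \<le> \<delta>"
      using that normsnd[of "z - z0"] normsnd[of "snd (z - z0)"] by (simp add: K_def dist_norm norm_minus_commute)
    then have "norm (E z - E0) \<le> e / 2" by (simp add: E_def z0_def \<delta>_def)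
    from norm_triangle_mono[OF this E0] show ?thesis by simp
  qed
  have subst: "?ubl (\<lambda>\<tau> z. \<Phi> (\<tau> *\<^sub>R t_var) (Y \<tau> z))" if "diamond_subst_ok s f \<Phi>"
    for f :: "real \<times> (real ^ 2) \<Rightarrow> real" and \<Phi>
  proof -
    have "\<forall>\<tau>\<in>?P. \<forall>z\<in>K. norm (\<tau> *\<^sub>R t_var) \<le> s \<and> (\<forall>k. norm (Y \<tau> z k) \<le> s)"
      using normT normY by blast
    then show ?thesis
      using that T Y unfolding diamond_subst_ok_def by simp
  qed
  have Psi: "?ubl (\<lambda>\<tau> z. \<Psi> (E z))"
    using inv E normE unfolding diamond_inverse_ok_def by simp
  have Q: "?ubl Qp" "?ubl Qm"
    unfolding Qp_def Qm_def by (intro ubl_intros P V subst[OF Rp] subst[OF Rm] subst[OF Up] subst[OF Um])+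
  have F: "?ubl F" unfolding F_def by (intro ubl_intros Q)
  have G: "?ubl (\<lambda>\<tau> z. G \<tau> z k)" for k
    unfolding G_def by (intro ubl_intros Q V Psi subst[OF Up] subst[OF Um])
  have "unif_bounded_lipschitz ?P (cball z0 \<delta>) H"
    unfolding H_def K_def[symmetric]
    by (intro ubl_intros unif_bounded_lipschitz_bounded_linear[OF bounded_linear_t_integral] F G)
  from unif_bounded_lipschitz_fixpoint[OF this \<tau>0(1) \<delta>]
  obtain \<tau> z where \<tau>: "0 < \<tau>" "\<tau> \<le> \<tau>0" and z: "z \<in> K" "z = z0 + \<tau> *\<^sub>R H \<tau> z"
    unfolding K_def by metis
  have Veq: "V z k = V0 k + \<tau> *\<^sub>R t_integral (G \<tau> z k)" for k
  proof -
    have "fst z = V0 1 + \<tau> *\<^sub>R t_integral (G \<tau> z 1)" "fst (snd z) = V0 2 + \<tau> *\<^sub>R t_integral (G \<tau> z 2)"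
      by (subst z(2), simp add: z0_def H_def)+
    then show ?thesis using exhaust_2[of k] by (auto simp: V_def)
  qed
  have Eeq: "E z = E0 + \<tau> *\<^sub>R t_integral (F \<tau> z)"
    unfolding E_def by (subst z(2), simp add: z0_def H_def)
  show thesis
  proof (rule that[of \<tau> "Y \<tau> z" "E z" "V z" "P \<tau> z" "G \<tau> z" "F \<tau> z" "Qp \<tau> z" "Qm \<tau> z"])
    show "\<tau> > 0" "\<tau> \<le> s" using \<tau> \<tau>0 by auto
    show "norm (Y \<tau> z k) \<le> s" for k using \<tau> z normY by simp
    show "norm (E z - a *\<^sub>R 1) \<le> e" using z normE by simp
  qed (fact Veq Eeq Y_def P_def Qp_def Qm_def F_def G_def)+
qed

theorem theorem3p1:
  fixes y0 v0 :: "real \<Rightarrow> real^2"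
    and \<eta>0 :: "real \<Rightarrow> real"
    and \<rho>p \<rho>m :: "real \<times> (real^2) \<Rightarrow> real"
    and vp vm :: "real \<times> (real^2) \<Rightarrow> real^2"
    and U :: "real set"
    and V :: "(real \<times> (real^2)) set"
  assumes "open U" and "0 \<in> U"
    and "y0 real_analytic_on U" and "v0 real_analytic_on U" and "\<eta>0 real_analytic_on U"
    and "y0 0 = 0" and "\<eta>0 0 > 0"
    and "\<And>t x. \<rho>p (t, x) \<ge> 0" and "\<And>t x. \<rho>m (t, x) \<ge> 0"
    and "open V" and "(0, 0) \<in> V"
    and "\<rho>p real_analytic_on V" and "\<rho>m real_analytic_on V"
    and "vp real_analytic_on V" and "vm real_analytic_on V"
  shows "\<exists>W :: (real \<times> real) set. open W \<and> (0, 0) \<in> W \<and>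
    (\<exists>(y :: real \<times> real \<Rightarrow> real^2) (v :: real \<times> real \<Rightarrow> real^2)
      (p :: real \<times> real \<Rightarrow> real^2) (\<eta> :: real \<times> real \<Rightarrow> real).
      y real_analytic_on W \<and> v real_analytic_on W \<and>
      p real_analytic_on W \<and> \<eta> real_analytic_on W \<and>
      (\<forall>(t, \<xi>)\<in>W.
        \<eta> (t, \<xi>) \<noteq> 0 \<and>
        p (t, \<xi>) = partial_xi y t \<xi> \<and>
        partial_t y t \<xi> = v (t, \<xi>) \<and>
        partial_t \<eta> t \<xi> =
          cross2 (p (t, \<xi>)) (v (t, \<xi>) - vp (t, y (t, \<xi>))) * \<rho>p (t, y (t, \<xi>))
          - cross2 (p (t, \<xi>)) (v (t, \<xi>) - vm (t, y (t, \<xi>))) * \<rho>m (t, y (t, \<xi>)) \<and>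
        partial_t v t \<xi> =
          (cross2 (p (t, \<xi>)) (v (t, \<xi>) - vp (t, y (t, \<xi>))) * \<rho>p (t, y (t, \<xi>)))
            *\<^sub>R ((vp (t, y (t, \<xi>)) - v (t, \<xi>)) /\<^sub>R \<eta> (t, \<xi>))
          - (cross2 (p (t, \<xi>)) (v (t, \<xi>) - vm (t, y (t, \<xi>))) * \<rho>m (t, y (t, \<xi>)))
            *\<^sub>R ((vm (t, y (t, \<xi>)) - v (t, \<xi>)) /\<^sub>R \<eta> (t, \<xi>)) \<and>
        partial_t p t \<xi> - partial_xi v t \<xi> = 0) \<and>
      (\<forall>\<^sub>F \<xi> in nhds 0.
        y (0, \<xi>) = y0 \<xi> \<and> \<eta> (0, \<xi>) = \<eta>0 \<xi> \<and> v (0, \<xi>) = v0 \<xi>))"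
proof -
  define a where "a = \<eta>0 0"
  have a: "a > 0" using assms by (simp add: a_def)
  have an0: "real_analytic_at (\<lambda>x. y0 x $ k) 0" "real_analytic_at (\<lambda>x. v0 x $ k) 0" "real_analytic_at \<eta>0 0" for k
    using assms(2-5) by (auto simp: real_analytic_on_def real_analytic_at_vec)
  have an: "real_analytic_at \<rho>p (0, 0)" "real_analytic_at \<rho>m (0, 0)"
    "real_analytic_at (\<lambda>q. vp q $ k) (0, 0)" "real_analytic_at (\<lambda>q. vm q $ k) (0, 0)" for k
    using assms(11-15) by (auto simp: real_analytic_on_def real_analytic_at_vec)
  obtain e \<Psi> where e: "e > 0" and inv: "diamond_inverse_ok e a \<Psi>"
    using diamond_inverse_ok_exists[OF a] by blast
  \<comment> \<open>Six scalar gas fields, two densities and four velocity components, have to admit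
    substitution with one common radius.\<close>
  have "\<forall>\<^sub>F s in at_right 0. s > 0 \<and> (\<exists>\<Phi>. diamond_subst_ok s \<rho>p \<Phi>) \<and> (\<exists>\<Phi>. diamond_subst_ok s \<rho>m \<Phi>) \<and>
      (\<forall>k. \<exists>\<Phi>. diamond_subst_ok s (\<lambda>q. vp q $ k) \<Phi>) \<and> (\<forall>k. \<exists>\<Phi>. diamond_subst_ok s (\<lambda>q. vm q $ k) \<Phi>)"
    by (intro eventually_conj eventually_all_finite diamond_subst_ok_eventually an eventually_at_right_less)
  then obtain s where "s > 0 \<and> (\<exists>\<Phi>. diamond_subst_ok s \<rho>p \<Phi>) \<and> (\<exists>\<Phi>. diamond_subst_ok s \<rho>m \<Phi>) \<and>
      (\<forall>k. \<exists>\<Phi>. diamond_subst_ok s (\<lambda>q. vp q $ k) \<Phi>) \<and> (\<forall>k. \<exists>\<Phi>. diamond_subst_ok s (\<lambda>q. vm q $ k) \<Phi>)"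
    using eventually_happens' trivial_limit_at_right_real by blast
  then obtain Rp Rm Up Um where s: "s > 0" and Rp: "diamond_subst_ok s \<rho>p Rp" and Rm: "diamond_subst_ok s \<rho>m Rm"
    and Up: "\<And>k. diamond_subst_ok s (\<lambda>q. vp q $ k) (Up k)" and Um: "\<And>k. diamond_subst_ok s (\<lambda>q. vm q $ k) (Um k)"
    by metis
  \<comment> \<open>The scale \<open>r\<close> is chosen after \<open>s\<close> and
    \<open>e\<close>. Only position and density are substituted into power series, so they must be
    close to constants; for the velocity any tolerance, here 1, will do.\<close>
  have pos: "s / 2 > 0" "e / 2 > 0" "(1::real) > 0" using s e by auto
  have "\<forall>\<^sub>F r in at_right 0. r > 0 \<and> (\<forall>k. \<exists>X Q. diamond_initial_datum (\<lambda>x. y0 x $ k) r (s / 2) X Q) \<and>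
      (\<forall>k. \<exists>X Q. diamond_initial_datum (\<lambda>x. v0 x $ k) r 1 X Q) \<and> (\<exists>X Q. diamond_initial_datum \<eta>0 r (e / 2) X Q)"
    by (intro eventually_conj eventually_all_finite diamond_initial_datum_exists an0 pos eventually_at_right_less)
  then obtain r where "r > 0 \<and> (\<forall>k. \<exists>X Q. diamond_initial_datum (\<lambda>x. y0 x $ k) r (s / 2) X Q) \<and>
      (\<forall>k. \<exists>X Q. diamond_initial_datum (\<lambda>x. v0 x $ k) r 1 X Q) \<and> (\<exists>X Q. diamond_initial_datum \<eta>0 r (e / 2) X Q)"
    using eventually_happens' trivial_limit_at_right_real by blast
  then obtain Y0 P0 V0 V0' E0 E0' where r: "r > 0"
    and Y0: "\<And>k. diamond_initial_datum (\<lambda>x. y0 x $ k) r (s / 2) (Y0 k) (P0 k)"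
    and V0: "\<And>k. diamond_initial_datum (\<lambda>x. v0 x $ k) r 1 (V0 k) (V0' k)"
    and E0: "diamond_initial_datum \<eta>0 r (e / 2) E0 E0'"
    by metis
  \<comment> \<open>Here \<open>y0 0 = 0\<close> enters: the datum is close to its value at 0, hence
    small, as required by the expansion of the gas fields about the origin.\<close>
  have "norm (Y0 k) \<le> s / 2" for k
    using Y0[of k] assms(6) by (simp add: diamond_initial_datum_def)
  moreover have "norm (E0 - a *\<^sub>R 1) \<le> e / 2"
    using E0 by (simp add: diamond_initial_datum_def a_def)
  ultimately show ?thesis
  proof (rule diamond_system_solution[where r=r, OF s e Rp Rm Up Um inv])
    fix \<tau> V Y P E F G Qp Qm
    assume \<tau>: "\<tau> > 0" "\<tau> \<le> s" and normY: "\<And>k. norm (Y k) \<le> s" and normE: "norm (E - a *\<^sub>R 1) \<le> e"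
      and Yeq: "\<And>k. Y k = Y0 k + \<tau> *\<^sub>R t_integral (V k)"
      and Peq: "\<And>k. P k = (1 / r) *\<^sub>R (P0 k + \<tau> *\<^sub>R x_deriv_t_integral (V k))"
      and Veq: "\<And>k. V k = V0 k + \<tau> *\<^sub>R t_integral (G k)"
      and Eeq: "E = E0 + \<tau> *\<^sub>R t_integral F"
      and Qp: "Qp = (P 1 * (V 2 - Up 2 (\<tau> *\<^sub>R t_var) Y) - P 2 * (V 1 - Up 1 (\<tau> *\<^sub>R t_var) Y)) * Rp (\<tau> *\<^sub>R t_var) Y"
      and Qm: "Qm = (P 1 * (V 2 - Um 2 (\<tau> *\<^sub>R t_var) Y) - P 2 * (V 1 - Um 1 (\<tau> *\<^sub>R t_var) Y)) * Rm (\<tau> *\<^sub>R t_var) Y"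
      and F: "F = Qp - Qm"
      and G: "\<And>k. G k = Qp * ((Up k (\<tau> *\<^sub>R t_var) Y - V k) * \<Psi> E) - Qm * ((Um k (\<tau> *\<^sub>R t_var) Y - V k) * \<Psi> E)"
    let ?W = "diamond \<tau> r" and ?T = "\<tau> *\<^sub>R t_var"
    define y v p where "y q = (\<chi> k. scaled_ev2 \<tau> r (Y k) q)" and "v q = (\<chi> k. scaled_ev2 \<tau> r (V k) q)"
      and "p q = (\<chi> k. scaled_ev2 \<tau> r (P k) q)" for q
    define \<eta> where "\<eta> = scaled_ev2 \<tau> r E"
    note components = y_def v_def p_def \<eta>_def
    have cY0: "coeff2 (Y0 k) (Suc i, j) = 0" "coeff2 (P0 k) = x_deriv_coeffs (coeff2 (Y0 k))"
      and cV0: "coeff2 (V0 k) (Suc i, j) = 0" and cE0: "coeff2 E0 (Suc i, j) = 0" for k i j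
      using Y0[of k] V0[of k] E0 by (auto simp: diamond_initial_datum_def)
    \<comment> \<open>The fixed point equations read off coefficientwise; the initial data do not
      contribute to positive powers of t.\<close>
    have Yt: "real (Suc i) * coeff2 (Y k) (Suc i, j) = \<tau> * coeff2 (V k) (i, j)"
      and Vt: "real (Suc i) * coeff2 (V k) (Suc i, j) = \<tau> * coeff2 (G k) (i, j)"
      and Et: "real (Suc i) * coeff2 E (Suc i, j) = \<tau> * coeff2 F (i, j)" for i j k
      by (simp_all add: Yeq[of k] Veq[of k] Eeq cY0 cV0 cE0 coeff2_t_integral del: of_nat_Suc)
    \<comment> \<open>For i = 0 the identity comes from the initial data, for i > 0 from the
      integral terms. The factor \<open>1 / r\<close> in \<open>P\<close> undoes the scaling of
      \<xi>.\<close>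
    have Yx: "real (Suc j) * coeff2 (Y k) (i, Suc j) = r * coeff2 (P k) (i, j)" for i j k
      using r by (cases i) (simp_all add: Yeq Peq cY0 x_deriv_coeffs_def coeff2_t_integral
        coeff2_x_deriv_t_integral distrib_left mult_ac del: of_nat_Suc)
    \<comment> \<open>The time derivative cancels the integration in \<open>P\<close> and leaves the
      x-derivative of \<open>V\<close>, so the last equation of the system holds by
      construction.\<close>
    have Pt: "r * real (Suc i) * coeff2 (P k) (Suc i, j) = \<tau> * real (Suc j) * coeff2 (V k) (i, Suc j)" for i j k
      using r by (simp add: Peq cY0 x_deriv_coeffs_def coeff2_x_deriv_t_integral del: of_nat_Suc)
    have equations: "\<eta> (t, \<xi>) \<noteq> 0 \<and>
        p (t, \<xi>) = partial_xi y t \<xi> \<and>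
        partial_t y t \<xi> = v (t, \<xi>) \<and>
        partial_t \<eta> t \<xi> =
          cross2 (p (t, \<xi>)) (v (t, \<xi>) - vp (t, y (t, \<xi>))) * \<rho>p (t, y (t, \<xi>))
          - cross2 (p (t, \<xi>)) (v (t, \<xi>) - vm (t, y (t, \<xi>))) * \<rho>m (t, y (t, \<xi>)) \<and>
        partial_t v t \<xi> =
          (cross2 (p (t, \<xi>)) (v (t, \<xi>) - vp (t, y (t, \<xi>))) * \<rho>p (t, y (t, \<xi>)))
            *\<^sub>R ((vp (t, y (t, \<xi>)) - v (t, \<xi>)) /\<^sub>R \<eta> (t, \<xi>))
          - (cross2 (p (t, \<xi>)) (v (t, \<xi>) - vm (t, y (t, \<xi>))) * \<rho>m (t, y (t, \<xi>)))
            *\<^sub>R ((vm (t, y (t, \<xi>)) - v (t, \<xi>)) /\<^sub>R \<eta> (t, \<xi>)) \<and>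
        partial_t p t \<xi> - partial_xi v t \<xi> = 0" if W: "(t, \<xi>) \<in> ?W" for t \<xi>
    proof -
      let ?q = "(t / \<tau>, \<xi> / r)"
      have q: "?q \<in> diamond 1 1" by (rule scaled_in_diamond[OF \<tau>(1) r W])
      have T: "norm ?T \<le> s" "ev2 ?q ?T = t"
        using \<tau> q by (simp_all add: norm_t_var ev2_t_var)
      have ev: "y (t, \<xi>) = (\<chi> k. ev2 ?q (Y k))" "v (t, \<xi>) $ k = ev2 ?q (V k)" "p (t, \<xi>) $ k = ev2 ?q (P k)"
        "\<eta> (t, \<xi>) = ev2 ?q E" for k
        by (simp_all add: components scaled_ev2_def)
      \<comment> \<open>Time and position have norm at most \<open>s\<close>, so evaluating a
        substituted series returns the field at the actual point of the curve.\<close>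
      have gas: "ev2 ?q (\<Phi> ?T Y) = f (t, y (t, \<xi>))" if "diamond_subst_ok s f \<Phi>"
        for f :: "real \<times> (real ^ 2) \<Rightarrow> real" and \<Phi>
      proof -
        have "ev2 ?q (\<Phi> ?T Y) = f (ev2 ?q ?T, \<chi> k. ev2 ?q (Y k))"
          using that q T(1) normY unfolding diamond_subst_ok_def by blast
        then show ?thesis unfolding ev T(2) .
      qed
      have evQp: "ev2 ?q Qp = cross2 (p (t, \<xi>)) (v (t, \<xi>) - vp (t, y (t, \<xi>))) * \<rho>p (t, y (t, \<xi>))"
        using q by (simp add: Qp cross2_def gas[OF Rp] gas[OF Up] ev(2,3))
      have evQm: "ev2 ?q Qm = cross2 (p (t, \<xi>)) (v (t, \<xi>) - vm (t, y (t, \<xi>))) * \<rho>m (t, y (t, \<xi>))"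
        using q by (simp add: Qm cross2_def gas[OF Rm] gas[OF Um] ev(2,3))
      have eta: "\<eta> (t, \<xi>) \<noteq> 0" "ev2 ?q (\<Psi> E) = 1 / \<eta> (t, \<xi>)"
        using inv q normE unfolding diamond_inverse_ok_def ev by blast+
      have "partial_xi y t \<xi> = p (t, \<xi>)"
        unfolding partial_xi_def
        by (rule vector_derivative_at, rule has_vector_derivative_vec)
          (simp add: y_def p_def scaled_ev2_x_derivative[OF \<tau>(1) r Yx W])
      moreover have "partial_t y t \<xi> = v (t, \<xi>)"
        unfolding partial_t_def
        by (rule vector_derivative_at, rule has_vector_derivative_vec)
          (simp add: y_def v_def scaled_ev2_t_derivative[OF \<tau>(1) r Yt W])
      moreover have "partial_t \<eta> t \<xi> = ev2 ?q Qp - ev2 ?q Qm"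
        unfolding partial_t_def
        by (rule vector_derivative_at)
          (use scaled_ev2_t_derivative[OF \<tau>(1) r Et W] q in \<open>simp add: \<eta>_def F scaled_ev2_def\<close>)
      moreover have "partial_t v t \<xi> = ev2 ?q Qp *\<^sub>R ((vp (t, y (t, \<xi>)) - v (t, \<xi>)) /\<^sub>R \<eta> (t, \<xi>))
          - ev2 ?q Qm *\<^sub>R ((vm (t, y (t, \<xi>)) - v (t, \<xi>)) /\<^sub>R \<eta> (t, \<xi>))"
      proof -
        have "partial_t v t \<xi> = (\<chi> k. ev2 ?q (G k))"
          unfolding partial_t_def
          by (rule vector_derivative_at, rule has_vector_derivative_vec)
            (use scaled_ev2_t_derivative[OF \<tau>(1) r Vt W] in \<open>simp add: v_def scaled_ev2_def\<close>)
        also have "\<dots> = ev2 ?q Qp *\<^sub>R ((vp (t, y (t, \<xi>)) - v (t, \<xi>)) /\<^sub>R \<eta> (t, \<xi>))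
          - ev2 ?q Qm *\<^sub>R ((vm (t, y (t, \<xi>)) - v (t, \<xi>)) /\<^sub>R \<eta> (t, \<xi>))"
          using q by (simp add: vec_eq_iff G gas[OF Up] gas[OF Um] eta(2) ev(2) inverse_eq_divide mult_ac)
        finally show ?thesis .
      qed
      moreover have "partial_t p t \<xi> = partial_xi v t \<xi>"
      proof -
        have "\<exists>d. ((\<lambda>s. p (s, \<xi>) $ k) has_vector_derivative d) (at t) \<and>
            ((\<lambda>s. v (t, s) $ k) has_vector_derivative d) (at \<xi>)" for k
          using scaled_ev2_mixed_derivative[OF \<tau>(1) r Pt[of _ k] W] by (simp add: p_def v_def)
        then obtain d where d: "\<And>k. ((\<lambda>s. p (s, \<xi>) $ k) has_vector_derivative d k) (at t)"
            "\<And>k. ((\<lambda>s. v (t, s) $ k) has_vector_derivative d k) (at \<xi>)"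
          by metis
        have "partial_t p t \<xi> = (\<chi> k. d k)" "partial_xi v t \<xi> = (\<chi> k. d k)"
          unfolding partial_t_def partial_xi_def
          by (rule vector_derivative_at, rule has_vector_derivative_vec, simp add: d)+
        then show ?thesis by simp
      qed
      ultimately show ?thesis
        using eta(1) by (simp add: evQp evQm)
    qed
    have initial: "\<forall>\<^sub>F \<xi> in nhds 0. y (0, \<xi>) = y0 \<xi> \<and> \<eta> (0, \<xi>) = \<eta>0 \<xi> \<and> v (0, \<xi>) = v0 \<xi>"
    proof -
      have "\<forall>\<^sub>F \<xi> in nhds 0. \<xi> \<in> {-r<..<r}"
        by (rule eventually_nhds_in_open) (use r in auto)
      then show ?thesis
      proof (rule eventually_mono)
        \<comment> \<open>On the line t = 0 the diamond is the interval |\<xi>| < r, and the time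
          integrals vanish there, leaving the initial data.\<close>
        fix \<xi> assume "\<xi> \<in> {-r<..<r}"
        then have q: "(0, \<xi> / r) \<in> diamond 1 1" using r by (simp add: diamond_def abs_less_iff field_simps)
        show "y (0, \<xi>) = y0 \<xi> \<and> \<eta> (0, \<xi>) = \<eta>0 \<xi> \<and> v (0, \<xi>) = v0 \<xi>"
          using q r Y0 V0 E0 unfolding diamond_initial_datum_def
          by (simp add: components scaled_ev2_def vec_eq_iff Yeq[of k for k] Eeq Veq[of k for k] ev2_t_integral_0)
      qed
    qed
    have analytic: "y real_analytic_on ?W" "v real_analytic_on ?W" "p real_analytic_on ?W" "\<eta> real_analytic_on ?W"
      unfolding real_analytic_on_def real_analytic_at_vec components
      using real_analytic_scaled_ev2[OF \<tau>(1) r] by simp_all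
    have "(0, 0) \<in> ?W" by (simp add: diamond_def)
    with open_diamond show ?thesis
      using analytic equations initial
      by (intro exI[of _ ?W] conjI exI[of _ y] exI[of _ v] exI[of _ p] exI[of _ \<eta>]) auto
  qed
qed

end
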